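(* Let $E$ be a real vector space of dimension $n\ge 1$, let $\mathcal G:E\to E^*$ be an oracle, $x_0\in E$, $R>0$, and assume there is $x^*\in B(x_0,R)$ with $\langle \mathcal G(x),x-x^*\rangle\ge 0$ for all $x\in E$. Run the General Scheme (see context) with coefficients $$a_k=\frac{\alpha_kR+\frac12\theta\gamma R_k}{\|g_k\|_{G_k}^*},\qquad b_k=\frac{\gamma}{(\|g_k\|_{G_k}^* )^2},\qquad k\ge 0,$$ where $$\alpha_k=\beta_k\sqrt{\frac{\theta}{\theta+1}},\qquad \theta=\sqrt[3]{2}-1,\qquad \gamma=\frac{2}{\sqrt{4n^2-1}+2n-1},$$ and $\beta_k>0$ $(k\ge 0)$ are arbitrary coefficients with $\beta_0\ge 1$. Assume $g_k\ne 0$ for all $k\ge 0$. Then, for all $k\ge 1$, the sliding gap $\Delta_k$ satisfies $$\Delta_k\le \begin{cases}\dfrac{2}{\sum_{i=0}^{k-1}\beta_i}\Bigl(1+\sum_{i=0}^{k-1}\beta_i^2\Bigr)R, & \text{if } k\le n^2,\\[2ex] 6e^{-k/(8n^2)}\Bigl(1+\sum_{i=0}^{k-1}\beta_i^2\Bigr)R, & \text{if } k\ge n^2.\end{cases}$$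
   Context: $E^*$ is the dual of $E$ and $\langle s,x\rangle$ is the value of $s\in E^*$ at $x\in E$. A self-adjoint positive definite operator $B:E\to E^*$ is fixed; $\|x\|=\langle Bx,x\rangle^{1/2}$ for $x\in E$, $\|s\|_*=\langle s,B^{-1}s\rangle^{1/2}$ for $s\in E^*$, $B(x_0,R)=\{x\in E:\|x-x_0\|\le R\}$. For a self-adjoint positive definite $G:E\to E^*$: $\|x\|_G=\langle Gx,x\rangle^{1/2}$, $\|s\|_G^*=\langle s,G^{-1}s\rangle^{1/2}$. For $s\in E^*$, $ss^*:E\to E^*$ is the rank-one operator $x\mapsto\langle s,x\rangle s$. General Scheme. Put $\ell_0(x)=0$, $\omega_0(x)=\frac12\|x-x_0\|^2$. For $k\ge 0$: (1) $g_k=\mathcal G(x_k)$; (2) $U_k=\max_{x\in\Omega_k\cap L_k^-}\langle g_k,x_k-x\rangle$, where $\Omega_k=\{x\in E:\omega_k(x)\le\frac12R^2\}$ and $L_k^-=\{x\in E:\ell_k(x)\le 0\}$; (3) with coefficients $a_k,b_k\ge 0$, set $\ell_{k+1}(x)=\ell_k(x)+a_k\langle g_k,x-x_k\rangle$ and $\omega_{k+1}(x)=\omega_k(x)+\frac12 b_k\bigl(U_k-\langle g_k,x_k-x\rangle\bigr)\langle g_k,x-x_k\rangle$; (4) $x_{k+1}=\arg\min_{x\in E}[\ell_{k+1}(x)+\omega_{k+1}(x)]$. Associated quantities: $G_0=B$, $G_{k+1}=G_k+b_kg_kg_k^*$ (the Hessian of $\omega_k$ is $G_k$); $R_0=R$,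 $R_k>0$ and $R_{k+1}^2=R_k^2+(a_k+\frac12b_kU_k)^2\dfrac{(\|g_k\|_{G_k}^* )^2}{1+b_k(\|g_k\|_{G_k}^* )^2}$. Sliding gap: for $k\ge 1$ with $\Gamma_k=\sum_{i=0}^{k-1}a_i\|g_i\|_*>0$, $\Delta_k=\max_{x\in\Omega_k}\frac1{\Gamma_k}[-\ell_k(x)]=\max_{x\in\Omega_k}\frac{1}{\Gamma_k}\sum_{i=0}^{k-1}a_i\langle g_i,x_i-x\rangle$. *)

theory Defs
  imports "HOL-Analysis.Analysis"
begin

text \<open>
  The space \<open>E\<close> is a type of class \<open>euclidean_space\<close>, of dimension \<open>DIM('a)\<close> (which is
  at least 1). The norm and inner product of that class are never referred to: all norms below come
  from operators \<open>E \<Rightarrow> E*\<close>. In finite dimension every linear functional is bounded, so the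
  bounded functionals are the whole dual.
\<close>

type_synonym 'a dual = "'a \<Rightarrow>\<^sub>L real"

abbreviation pairing :: "'a::euclidean_space dual \<Rightarrow> 'a \<Rightarrow> real"  (\<open>\<langle>_,/ _\<rangle>\<close>)
  where "\<langle>s, x\<rangle> \<equiv> blinfun_apply s x"

definition self_adjoint_pos_def :: "('a::euclidean_space \<Rightarrow> 'a dual) \<Rightarrow> bool"
  where "self_adjoint_pos_def G \<longleftrightarrow>
    linear G \<and> (\<forall>x y. \<langle>G x, y\<rangle> = \<langle>G y, x\<rangle>) \<and> (\<forall>x. x \<noteq> 0 \<longrightarrow> \<langle>G x, x\<rangle> > 0)"

definition op_norm :: "('a::euclidean_space \<Rightarrow> 'a dual) \<Rightarrow> 'a \<Rightarrow> real"
  where "op_norm G x = sqrt \<langle>G x, x\<rangle>"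

definition op_dual_norm :: "('a::euclidean_space \<Rightarrow> 'a dual) \<Rightarrow> 'a dual \<Rightarrow> real"
  where "op_dual_norm G s = sqrt \<langle>s, inv G s\<rangle>"

definition op_ball :: "('a::euclidean_space \<Rightarrow> 'a dual) \<Rightarrow> 'a \<Rightarrow> real \<Rightarrow> 'a set"
  where "op_ball B x0 R = {x. op_norm B (x - x0) \<le> R}"

definition rank_one :: "'a::euclidean_space dual \<Rightarrow> 'a \<Rightarrow> 'a dual"
  where "rank_one s = (\<lambda>x. \<langle>s, x\<rangle> *\<^sub>R s)"

text \<open>
  The attained maximum of \<open>f\<close> over \<open>S\<close>. It is an unspecified real if the maximum is not attained,
  so nothing can be concluded about it without proving attainment.
\<close>

definition max_over :: "'b set \<Rightarrow> ('b \<Rightarrow> real) \<Rightarrow> real"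
  where "max_over S f = (GREATEST v. v \<in> f ` S)"

definition Omega_set :: "real \<Rightarrow> ('a \<Rightarrow> real) \<Rightarrow> 'a set"
  where "Omega_set R w = {x. w x \<le> 1/2 * R\<^sup>2}"

definition L_minus :: "('a \<Rightarrow> real) \<Rightarrow> 'a set"
  where "L_minus l = {x. l x \<le> 0}"

text \<open>
  The sequences \<open>x, g, U, l, w\<close> are produced by the scheme with oracle \<open>orc\<close>, starting point
  \<open>x0\<close>, radius \<open>R\<close> and coefficients \<open>a, b\<close>. The scheme is given by a relation between
  the sequences since the coefficients may depend on earlier iterates.
\<close>

definition general_scheme ::
  "('a::euclidean_space \<Rightarrow> 'a dual) \<Rightarrow> ('a \<Rightarrow> 'a dual) \<Rightarrow> 'a \<Rightarrow> real \<Rightarrow>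
   (nat \<Rightarrow> real) \<Rightarrow> (nat \<Rightarrow> real) \<Rightarrow>
   (nat \<Rightarrow> 'a) \<Rightarrow> (nat \<Rightarrow> 'a dual) \<Rightarrow> (nat \<Rightarrow> real) \<Rightarrow>
   (nat \<Rightarrow> 'a \<Rightarrow> real) \<Rightarrow> (nat \<Rightarrow> 'a \<Rightarrow> real) \<Rightarrow> bool"
  where "general_scheme B orc x0 R a b x g U l w \<longleftrightarrow>
    x 0 = x0 \<and>
    l 0 = (\<lambda>y. 0) \<and>
    w 0 = (\<lambda>y. 1/2 * (op_norm B (y - x0))\<^sup>2) \<and>
    (\<forall>k. a k \<ge> 0 \<and> b k \<ge> 0 \<and>
      g k = orc (x k) \<and>
      U k = max_over (Omega_set R (w k) \<inter> L_minus (l k)) (\<lambda>y. \<langle>g k, x k - y\<rangle>) \<and>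
      l (Suc k) = (\<lambda>y. l k y + a k * \<langle>g k, y - x k\<rangle>) \<and>
      w (Suc k) = (\<lambda>y. w k y
        + 1/2 * b k * (U k - \<langle>g k, x k - y\<rangle>) * \<langle>g k, y - x k\<rangle>) \<and>
      x (Suc k) = arg_min_on (\<lambda>y. l (Suc k) y + w (Suc k) y) UNIV)"

definition hessian_sequence ::
  "('a::euclidean_space \<Rightarrow> 'a dual) \<Rightarrow> (nat \<Rightarrow> real) \<Rightarrow> (nat \<Rightarrow> 'a dual) \<Rightarrow>
   (nat \<Rightarrow> 'a \<Rightarrow> 'a dual) \<Rightarrow> bool"
  where "hessian_sequence B b g G \<longleftrightarrow>
    G 0 = B \<and> (\<forall>k. G (Suc k) = (\<lambda>y. G k y + b k *\<^sub>R rank_one (g k) y))"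

definition radius_sequence ::
  "real \<Rightarrow> (nat \<Rightarrow> real) \<Rightarrow> (nat \<Rightarrow> real) \<Rightarrow> (nat \<Rightarrow> 'a::euclidean_space dual) \<Rightarrow>
   (nat \<Rightarrow> real) \<Rightarrow> (nat \<Rightarrow> 'a \<Rightarrow> 'a dual) \<Rightarrow> (nat \<Rightarrow> real) \<Rightarrow> bool"
  where "radius_sequence R a b g U G r \<longleftrightarrow>
    r 0 = R \<and>
    (\<forall>k. r k > 0 \<and>
      (r (Suc k))\<^sup>2 = (r k)\<^sup>2 + (a k + 1/2 * b k * U k)\<^sup>2 *
        ((op_dual_norm (G k) (g k))\<^sup>2 / (1 + b k * (op_dual_norm (G k) (g k))\<^sup>2)))"

definition Gamma_sum ::
  "('a::euclidean_space \<Rightarrow> 'a dual) \<Rightarrow> (nat \<Rightarrow> real) \<Rightarrow> (nat \<Rightarrow> 'a dual) \<Rightarrow> nat \<Rightarrow> real"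
  where "Gamma_sum B a g k = (\<Sum>i<k. a i * op_dual_norm B (g i))"

definition sliding_gap ::
  "('a::euclidean_space \<Rightarrow> 'a dual) \<Rightarrow> real \<Rightarrow> (nat \<Rightarrow> real) \<Rightarrow> (nat \<Rightarrow> 'a dual) \<Rightarrow>
   (nat \<Rightarrow> 'a \<Rightarrow> real) \<Rightarrow> (nat \<Rightarrow> 'a \<Rightarrow> real) \<Rightarrow> nat \<Rightarrow> real"
  where "sliding_gap B R a g l w k =
    max_over (Omega_set R (w k)) (\<lambda>y. 1 / Gamma_sum B a g k * (- l k y))"

definition theta_const :: real
  where "theta_const = root 3 2 - 1"

definition gamma_const :: "nat \<Rightarrow> real"
  where "gamma_const n = 2 / (sqrt (4 * (real n)\<^sup>2 - 1) + 2 * real n - 1)"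

end

theory Submission
  imports Defs
begin

text \<open>
  The function \<open>l k + w k\<close> is a quadratic with Hessian \<open>G k\<close>, minimizer \<open>x k\<close> and minimum
  \<open>(R\<^sup>2 - (r k)\<^sup>2) / 2\<close>. Hence \<open>- l k \<le> (r k)\<^sup>2 / 2\<close> on the localizer, and the gap is at most
  \<open>(r k)\<^sup>2 / (2 * Gamma_sum B a g k)\<close>. The choice of \<open>\<alpha>\<close> and \<open>\<theta>\<close> (with \<open>(1 + \<theta>) ^ 3 = 2\<close>) gives
  \<open>(r k)\<^sup>2 \<le> q ^ k * (1 + (\<Sum>i<k. (\<beta> i)\<^sup>2)) * R\<^sup>2\<close> with \<open>q = 1 + \<gamma>\<^sup>2 / (2 * (1 + \<gamma>))\<close>. The weights
  grow linearly because the dual norms of \<open>G k\<close> are dominated by those of \<open>B\<close>; they grow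
  exponentially because the determinant of \<open>G k\<close> relative to \<open>B\<close> is \<open>(1 + \<gamma>) ^ k\<close>, which forces the
  trace, and with it the squared ratios of the two dual norms, to be large. With \<open>y = 1 / (2 * n)\<close> the choice of
  \<open>\<gamma>\<close> makes \<open>ln (1 + \<gamma>) = artanh y\<close> and \<open>ln q = - ln (1 - y\<^sup>2) / 2\<close>, so the exponential rate amounts
  to \<open>- ln (1 - y\<^sup>2) / 2 + y\<^sup>2 / 2 \<le> y * artanh y\<close>.
\<close>

section \<open>Positive definite operators and conjugate bases\<close>

locale pos_def_operator =
  fixes G :: "'a::euclidean_space \<Rightarrow> 'a dual"
  assumes self_adjoint_pos_def: "self_adjoint_pos_def G"
begin

lemma linear: "linear G"
  and sym: "\<langle>G x, y\<rangle> = \<langle>G y, x\<rangle>"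
  and pos: "x \<noteq> 0 \<Longrightarrow> \<langle>G x, x\<rangle> > 0"
  using self_adjoint_pos_def by (auto simp: self_adjoint_pos_def_def)

lemmas linear_simps = linear_add[OF linear] linear_diff[OF linear] linear_scale[OF linear]
  linear_0[OF linear] linear_sum[OF linear]

lemmas expand = linear_simps blinfun.add_left blinfun.add_right blinfun.diff_left
  blinfun.diff_right blinfun.scaleR_left blinfun.scaleR_right blinfun.sum_left blinfun.sum_right

lemma nonneg: "\<langle>G x, x\<rangle> \<ge> 0"
  using pos[of x] by (cases "x = 0") (auto simp: linear_simps)

lemma injective: "inj G"
proof (rule injI)
  fix x y assume "G x = G y"
  then have "\<langle>G (x - y), x - y\<rangle> = 0"
    by (simp add: linear_simps)
  then show "x = y"
    using pos[of "x - y"] by fastforce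
qed

lemma Cauchy_Schwarz: "\<langle>G u, x\<rangle>\<^sup>2 \<le> \<langle>G u, u\<rangle> * \<langle>G x, x\<rangle>"
proof (cases "x = 0")
  case False
  let ?c = "\<langle>G x, x\<rangle>"
  have "0 \<le> \<langle>G (?c *\<^sub>R u - \<langle>G u, x\<rangle> *\<^sub>R x), ?c *\<^sub>R u - \<langle>G u, x\<rangle> *\<^sub>R x\<rangle>"
    by (rule nonneg)
  also have "\<dots> = ?c * (\<langle>G u, u\<rangle> * ?c - \<langle>G u, x\<rangle>\<^sup>2)"
    by (simp add: expand sym[of x u] algebra_simps power2_eq_square)
  finally show ?thesis
    using pos[OF False] by (simp add: zero_le_mult_iff)
qed (simp add: linear_simps)

text \<open>The form attains its minimum on the unit sphere by compactness, and homogeneity carries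
  the bound to all vectors. This is what makes sublevel sets of quadratic models bounded.\<close>

lemma coercive: obtains c where "c > 0" "\<And>x. c * (norm x)\<^sup>2 \<le> \<langle>G x, x\<rangle>"
proof -
  obtain i :: 'a where "i \<in> Basis" using nonempty_Basis by blast
  then have ne: "sphere (0::'a) 1 \<noteq> {}" by (auto intro!: exI[of _ i])
  have "continuous_on (sphere 0 1) (\<lambda>x. \<langle>G x, x\<rangle>)"
    by (intro continuous_intros linear_continuous_on linear_conv_bounded_linear[THEN iffD1] linear)
  then obtain z where z: "z \<in> sphere 0 1" "\<And>y. y \<in> sphere 0 1 \<Longrightarrow> \<langle>G z, z\<rangle> \<le> \<langle>G y, y\<rangle>"
    using continuous_attains_inf[OF compact_sphere ne] by blast
  show ?thesis
  proof
    show "\<langle>G z, z\<rangle> > 0" using z(1) by (intro pos) auto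
    show "\<langle>G z, z\<rangle> * (norm x)\<^sup>2 \<le> \<langle>G x, x\<rangle>" for x
    proof (cases "x = 0")
      case False
      have "\<langle>G z, z\<rangle> \<le> \<langle>G (x /\<^sub>R norm x), x /\<^sub>R norm x\<rangle>"
        using False by (intro z(2)) auto
      also have "\<dots> = \<langle>G x, x\<rangle> / (norm x)\<^sup>2"
        by (simp add: expand field_simps power2_eq_square)
      finally show ?thesis using False by (simp add: field_simps)
    qed (simp add: linear_simps)
  qed
qed

end

text \<open>Indexing by \<open>nat\<close> lets triangular changes of basis be stated through spans
  of initial segments. The vectors are not normalized: the values
  \<open>\<langle>G (f i), f i\<rangle>\<close> form the diagonal factor of an LDL^T
  factorization.\<close>

definition conjugate_basis :: "('a::euclidean_space \<Rightarrow> 'a dual) \<Rightarrow> (nat \<Rightarrow> 'a) \<Rightarrow> bool"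
  where "conjugate_basis G f \<longleftrightarrow>
    (\<forall>i<DIM('a). \<forall>j<DIM('a). i \<noteq> j \<longrightarrow> \<langle>G (f i), f j\<rangle> = 0) \<and>
    (\<forall>i<DIM('a). f i \<noteq> 0) \<and> span (f ` {..<DIM('a)}) = UNIV"

text \<open>In a conjugate basis the Gram matrix of \<open>G\<close> is diagonal and this is its
  determinant. If \<open>f\<close> arises from a \<open>B\<close>-orthonormal basis by a unit
  triangular change, it is the determinant of \<open>G\<close> relative to \<open>B\<close>.\<close>

definition gram_det :: "('a::euclidean_space \<Rightarrow> 'a dual) \<Rightarrow> (nat \<Rightarrow> 'a) \<Rightarrow> real"
  where "gram_det G f = (\<Prod>i<DIM('a). \<langle>G (f i), f i\<rangle>)"

context pos_def_operator
begin

text \<open>Gram-Schmidt for the inner product given by \<open>G\<close>. The dimension is carried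
  along so that a sequence of full length spans the space.\<close>

lemma orthonormal_sequence_exists:
  assumes "m \<le> DIM('a)"
  shows "\<exists>f. (\<forall>i<m. \<forall>j<m. \<langle>G (f i), f j\<rangle> = (if i = j then 1 else 0)) \<and> dim (f ` {..<m}) = m"
  using assms
proof (induction m)
  case (Suc m)
  then obtain f where f: "\<And>i j. i < m \<Longrightarrow> j < m \<Longrightarrow> \<langle>G (f i), f j\<rangle> = (if i = j then 1 else 0)"
    and d: "dim (f ` {..<m}) = m" by auto
  have "span (f ` {..<m}) \<noteq> UNIV"
    using d Suc.prems dim_eq_full[of "f ` {..<m}"] by auto
  then obtain v where v: "v \<notin> span (f ` {..<m})" by auto
  define u where "u = v - (\<Sum>i<m. \<langle>G v, f i\<rangle> *\<^sub>R f i)"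
  have u: "u \<notin> span (f ` {..<m})"
  proof
    assume "u \<in> span (f ` {..<m})"
    moreover have "(\<Sum>i<m. \<langle>G v, f i\<rangle> *\<^sub>R f i) \<in> span (f ` {..<m})"
      by (intro span_sum span_mul span_base) auto
    ultimately show False
      using v span_add[of u "f ` {..<m}" "\<Sum>i<m. \<langle>G v, f i\<rangle> *\<^sub>R f i"] by (simp add: u_def)
  qed
  have orth: "\<langle>G u, f j\<rangle> = 0" if "j < m" for j
  proof -
    have "\<langle>G u, f j\<rangle> = \<langle>G v, f j\<rangle> - (\<Sum>i<m. \<langle>G v, f i\<rangle> * \<langle>G (f i), f j\<rangle>)"
      by (simp add: u_def expand)
    also have "(\<Sum>i<m. \<langle>G v, f i\<rangle> * \<langle>G (f i), f j\<rangle>) = (\<Sum>i<m. if i = j then \<langle>G v, f i\<rangle> else 0)"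
      using f that by (intro sum.cong) auto
    finally show ?thesis using that by simp
  qed
  have "u \<noteq> 0" using u span_zero by metis
  then have up: "\<langle>G u, u\<rangle> > 0" by (rule pos)
  define e where "e = (1 / sqrt \<langle>G u, u\<rangle>) *\<^sub>R u"
  have e1: "\<langle>G e, e\<rangle> = 1" using up by (simp add: e_def expand)
  have e0: "\<langle>G e, f j\<rangle> = 0" if "j < m" for j using orth[OF that] by (simp add: e_def expand)
  have e: "e \<notin> span (f ` {..<m})"
  proof
    assume "e \<in> span (f ` {..<m})"
    then have "sqrt \<langle>G u, u\<rangle> *\<^sub>R e \<in> span (f ` {..<m})" by (rule span_mul)
    then show False using u up by (simp add: e_def)
  qed
  let ?f = "f(m := e)"
  have im: "?f ` {..<Suc m} = insert e (f ` {..<m})"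
    by (auto simp: lessThan_Suc)
  have "\<langle>G (?f i), ?f j\<rangle> = (if i = j then 1 else 0)" if "i < Suc m" "j < Suc m" for i j
    using that f[of i j] e0[of i] e0[of j] e1 sym[of "f i" e] by (auto simp: less_Suc_eq)
  then show ?case
    using dim_insert[of e "f ` {..<m}"] e d im by (intro exI[of _ ?f]) auto
qed auto

lemma orthonormal_basis_exists:
  obtains e where "conjugate_basis G e" "\<And>i. i < DIM('a) \<Longrightarrow> \<langle>G (e i), e i\<rangle> = 1"
proof -
  obtain e where e: "\<And>i j. i < DIM('a) \<Longrightarrow> j < DIM('a) \<Longrightarrow> \<langle>G (e i), e j\<rangle> = (if i = j then 1 else 0)"
    and d: "dim (e ` {..<DIM('a)}) = DIM('a)"
    using orthonormal_sequence_exists[OF order_refl] by auto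
  have "e i \<noteq> 0" if "i < DIM('a)" for i
    using e[OF that that] by (auto simp: linear_simps)
  moreover have "span (e ` {..<DIM('a)}) = UNIV" using d dim_eq_full by blast
  ultimately have "conjugate_basis G e" using e by (auto simp: conjugate_basis_def)
  then show ?thesis using that e by simp
qed

lemma blinfun_eq_on_span:
  fixes s t :: "'a dual"
  assumes "span S = UNIV" "\<And>x. x \<in> S \<Longrightarrow> \<langle>s, x\<rangle> = \<langle>t, x\<rangle>"
  shows "s = t"
proof (rule blinfun_eqI)
  fix x
  have "x \<in> span S" using assms(1) by simp
  then show "\<langle>s, x\<rangle> = \<langle>t, x\<rangle>"
    by (intro linear_eq_on[OF _ _ _ assms(2)] bounded_linear.linear blinfun.bounded_linear_right)
qed

text \<open>Conjugacy leaves a single term of the sum on each basis vector. The expansion yields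
  surjectivity of \<open>G\<close>, so that \<open>inv G\<close> is a genuine inverse, and a
  coordinate formula for the dual norm.\<close>

lemma preimage_expansion:
  assumes "conjugate_basis G f"
  shows "G (\<Sum>i<DIM('a). (\<langle>s, f i\<rangle> / \<langle>G (f i), f i\<rangle>) *\<^sub>R f i) = s"
proof (rule blinfun_eq_on_span)
  show "span (f ` {..<DIM('a)}) = UNIV" using assms by (simp add: conjugate_basis_def)
  fix y assume "y \<in> f ` {..<DIM('a)}"
  then obtain j where j: "j < DIM('a)" "y = f j" by auto
  have "\<langle>G (\<Sum>i<DIM('a). (\<langle>s, f i\<rangle> / \<langle>G (f i), f i\<rangle>) *\<^sub>R f i), y\<rangle>
    = (\<Sum>i<DIM('a). (\<langle>s, f i\<rangle> / \<langle>G (f i), f i\<rangle>) * \<langle>G (f i), f j\<rangle>)"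
    by (simp add: expand j)
  also have "\<dots> = (\<Sum>i<DIM('a). if i = j then \<langle>s, f i\<rangle> else 0)"
    using assms j pos by (intro sum.cong) (force simp: conjugate_basis_def)+
  also have "\<dots> = \<langle>s, y\<rangle>" using j by simp
  finally show "\<langle>G (\<Sum>i<DIM('a). (\<langle>s, f i\<rangle> / \<langle>G (f i), f i\<rangle>) *\<^sub>R f i), y\<rangle> = \<langle>s, y\<rangle>" .
qed

lemma inv_right [simp]: "G (inv G s) = s"
proof -
  obtain e where "conjugate_basis G e" by (rule orthonormal_basis_exists)
  then have "s \<in> range G" using preimage_expansion[of e s] by (metis rangeI)
  then show ?thesis by (rule f_inv_into_f)
qed

lemma dual_sq_nonneg: "\<langle>s, inv G s\<rangle> \<ge> 0"
  using nonneg[of "inv G s"] by simp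

lemma op_dual_norm_sq: "(op_dual_norm G s)\<^sup>2 = \<langle>s, inv G s\<rangle>"
  using dual_sq_nonneg by (simp add: op_dual_norm_def)

lemma op_dual_norm_nonneg: "op_dual_norm G s \<ge> 0"
  using dual_sq_nonneg by (simp add: op_dual_norm_def)

lemma op_dual_norm_pos:
  assumes "s \<noteq> 0" shows "op_dual_norm G s > 0"
proof -
  have "inv G s \<noteq> 0" using assms inv_right[of s] linear_0[OF linear] by metis
  then show ?thesis using pos[of "inv G s"] by (simp add: op_dual_norm_def)
qed

lemma op_dual_norm_sq_expansion:
  assumes "conjugate_basis G f"
  shows "(op_dual_norm G s)\<^sup>2 = (\<Sum>i<DIM('a). \<langle>s, f i\<rangle>\<^sup>2 / \<langle>G (f i), f i\<rangle>)"
proof -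
  have "inv G s = (\<Sum>i<DIM('a). (\<langle>s, f i\<rangle> / \<langle>G (f i), f i\<rangle>) *\<^sub>R f i)"
    using preimage_expansion[OF assms, of s] injective by (simp add: inv_f_eq)
  then show ?thesis
    unfolding op_dual_norm_sq by (simp add: blinfun.sum_right blinfun.scaleR_right power2_eq_square)
qed

lemma dual_Cauchy_Schwarz: "\<langle>s, x\<rangle>\<^sup>2 \<le> (op_dual_norm G s)\<^sup>2 * \<langle>G x, x\<rangle>"
  using Cauchy_Schwarz[of "inv G s" x] by (simp add: op_dual_norm_sq)

text \<open>For \<open>v = inv G s\<close>, Cauchy-Schwarz for \<open>B\<close> and the domination
  by \<open>G\<close> give \<open>\<langle>s, v\<rangle>\<^sup>2 \<le> (op_dual_norm B s)\<^sup>2 *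
  \<langle>s, v\<rangle>\<close>; cancelling one factor leaves the squared claim.\<close>

lemma op_dual_norm_antimono:
  assumes B: "pos_def_operator B" and le: "\<And>x. \<langle>B x, x\<rangle> \<le> \<langle>G x, x\<rangle>"
  shows "op_dual_norm G s \<le> op_dual_norm B s"
proof -
  interpret B: pos_def_operator B by (rule B)
  define v where "v = inv G s"
  have v: "\<langle>G v, v\<rangle> = \<langle>s, v\<rangle>" by (simp add: v_def)
  have "\<langle>s, v\<rangle>\<^sup>2 \<le> (op_dual_norm B s)\<^sup>2 * \<langle>B v, v\<rangle>" by (rule B.dual_Cauchy_Schwarz)
  also have "\<dots> \<le> (op_dual_norm B s)\<^sup>2 * \<langle>s, v\<rangle>"
    using le[of v] v by (intro mult_left_mono) auto
  finally have "\<langle>s, v\<rangle> * \<langle>s, v\<rangle> \<le> (op_dual_norm B s)\<^sup>2 * \<langle>s, v\<rangle>" by (simp add: power2_eq_square)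
  moreover have "\<langle>s, v\<rangle> \<ge> 0" using dual_sq_nonneg by (simp add: v_def)
  ultimately have "\<langle>s, v\<rangle> \<le> (op_dual_norm B s)\<^sup>2"
    by (cases "\<langle>s, v\<rangle> = 0") (auto simp: mult_le_cancel_right)
  then have "(op_dual_norm G s)\<^sup>2 \<le> (op_dual_norm B s)\<^sup>2" by (simp add: op_dual_norm_sq v_def)
  then show ?thesis using B.op_dual_norm_nonneg power2_le_imp_le by blast
qed

lemma rank_one_update_pos_def:
  assumes "c \<ge> 0"
  shows "pos_def_operator (\<lambda>y. G y + c *\<^sub>R rank_one s y)"
proof
  have "linear (\<lambda>y. G y + c *\<^sub>R rank_one s y)"
    by (rule linearI) (simp_all add: rank_one_def linear_simps blinfun.add_right
      blinfun.scaleR_right algebra_simps)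
  moreover have "\<langle>G x, x\<rangle> + c * \<langle>s, x\<rangle> * \<langle>s, x\<rangle> > 0" if "x \<noteq> 0" for x
    using pos[OF that] assms by (intro add_pos_nonneg) (auto simp: mult.assoc)
  ultimately show "self_adjoint_pos_def (\<lambda>y. G y + c *\<^sub>R rank_one s y)"
    by (auto simp: self_adjoint_pos_def_def rank_one_def blinfun.add_left blinfun.scaleR_left sym)
qed

end

section \<open>Determinants through triangular changes of a conjugate basis\<close>

context pos_def_operator
begin

text \<open>Hadamard's inequality. The difference \<open>v\<close> of \<open>f j\<close> and
  \<open>e j\<close> lies in the span of earlier vectors, to which \<open>f j\<close> is
  \<open>G\<close>-orthogonal, so by Pythagoras \<open>e j\<close> has the energy of
  \<open>f j\<close> plus that of \<open>v\<close>.\<close>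

lemma gram_det_le:
  assumes f: "conjugate_basis G f"
    and e: "\<And>j. j < DIM('a) \<Longrightarrow> f j - e j \<in> span (f ` {..<j})"
  shows "gram_det G f \<le> (\<Prod>j<DIM('a). \<langle>G (e j), e j\<rangle>)"
  unfolding gram_det_def
proof (rule prod_mono, safe)
  fix j assume j: "j < DIM('a)"
  show "0 \<le> \<langle>G (f j), f j\<rangle>" by (rule nonneg)
  define v where "v = f j - e j"
  have "\<langle>G (f j), v\<rangle> = \<langle>0, v\<rangle>"
    using e[OF j, folded v_def]
  proof (rule linear_eq_on[rotated 2])
    show "\<langle>G (f j), b\<rangle> = \<langle>0, b\<rangle>" if "b \<in> f ` {..<j}" for b
      using that f j by (auto simp: conjugate_basis_def)
  qed (intro bounded_linear.linear blinfun.bounded_linear_right)+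
  then have "\<langle>G (f j), v\<rangle> = 0" by simp
  moreover have "e j = f j - v" by (simp add: v_def)
  ultimately have "\<langle>G (e j), e j\<rangle> = \<langle>G (f j), f j\<rangle> + \<langle>G v, v\<rangle>"
    using sym[of v "f j"] by (simp add: expand)
  then show "\<langle>G (f j), f j\<rangle> \<le> \<langle>G (e j), e j\<rangle>" using nonneg[of v] by simp
qed

text \<open>The rank-one update of an \<open>LDL\<^sup>T\<close> factorization: it replaces the matrix determinant
  lemma, with \<^term>\<open>gram_det G f\<close> in the role of the determinant.\<close>

lemma conjugate_basis_rank_one_update:
  assumes f: "conjugate_basis G f" and c: "c \<ge> 0"
  obtains f' where "conjugate_basis (\<lambda>y. G y + c *\<^sub>R rank_one s y) f'"
    and "gram_det (\<lambda>y. G y + c *\<^sub>R rank_one s y) f' = (1 + c * (op_dual_norm G s)\<^sup>2) * gram_det G f"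
    and "\<And>j. j < DIM('a) \<Longrightarrow> f' j - f j \<in> span (f ` {..<j})"
    and "\<And>j. j \<le> DIM('a) \<Longrightarrow> span (f' ` {..<j}) = span (f ` {..<j})"
proof -
  let ?n = "DIM('a)"
  define G' where "G' = (\<lambda>y. G y + c *\<^sub>R rank_one s y)"
  define h where "h i = \<langle>G (f i), f i\<rangle>" for i
  define t where "t i = \<langle>s, f i\<rangle>" for i
  \<comment> \<open>\<open>p j\<close> is the \<open>G\<close>-preimage of \<open>s\<close>
    truncated to the first \<open>j\<close> basis vectors, and \<open>S j\<close> is the squared
    dual norm of that truncation.\<close>
  define p where "p j = (\<Sum>i<j. (t i / h i) *\<^sub>R f i)" for j
  define S where "S j = (\<Sum>i<j. (t i)\<^sup>2 / h i)" for j
  \<comment> \<open>\<open>d j\<close> solves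
    \<open>d j = c * \<langle>s, f j - d j *\<^sub>R p j\<rangle>\<close>. With this choice the
    rank-one term cancels the \<open>G\<close>-product of \<open>f' j\<close> with every earlier
    \<open>f i\<close>.\<close>
  define d where "d j = c * t j / (1 + c * S j)" for j
  define f' where "f' j = f j - d j *\<^sub>R p j" for j
  interpret G': pos_def_operator G'
    unfolding G'_def by (rule rank_one_update_pos_def[OF c])
  have h: "h i > 0" if "i < ?n" for i
    using f that pos by (auto simp: conjugate_basis_def h_def)
  have S1: "1 + c * S j > 0" if "j \<le> ?n" for j
  proof -
    have "S j \<ge> 0" unfolding S_def using that h by (intro sum_nonneg divide_nonneg_pos) auto
    then show ?thesis using c by (simp add: add_pos_nonneg)
  qed
  have sp: "\<langle>s, p j\<rangle> = S j" for j
    by (simp add: p_def S_def blinfun.sum_right blinfun.scaleR_right t_def power2_eq_square)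
  have Gp: "\<langle>G (p j), f i\<rangle> = (if i < j then t i else 0)" if "i < ?n" "j \<le> ?n" for i j
  proof -
    have "\<langle>G (p j), f i\<rangle> = (\<Sum>k<j. (t k / h k) * \<langle>G (f k), f i\<rangle>)"
      by (simp add: p_def expand)
    also have "\<dots> = (\<Sum>k<j. if k = i then t k else 0)"
    proof (rule sum.cong)
      fix k assume "k \<in> {..<j}"
      then show "(t k / h k) * \<langle>G (f k), f i\<rangle> = (if k = i then t k else 0)"
        using f that h[of i] by (cases "k = i") (auto simp: conjugate_basis_def h_def)
    qed simp
    finally show ?thesis by simp
  qed
  have cs: "c * \<langle>s, f' j\<rangle> = d j" if "j \<le> ?n" for j
    using S1[OF that] by (simp add: f'_def expand sp d_def t_def field_simps)
  have G'_apply: "\<langle>G' u, v\<rangle> = \<langle>G u, v\<rangle> + c * \<langle>s, u\<rangle> * \<langle>s, v\<rangle>" for u v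
    by (simp add: G'_def rank_one_def blinfun.add_left blinfun.scaleR_left)
  have G'0: "\<langle>G' (f' j), f i\<rangle> = 0" if "i < j" "j < ?n" for i j
  proof -
    have "\<langle>G (f' j), f i\<rangle> = - (d j * t i)"
      using that f by (simp add: f'_def expand Gp conjugate_basis_def)
    moreover have "c * \<langle>s, f' j\<rangle> * \<langle>s, f i\<rangle> = d j * t i"
      using that by (simp add: cs t_def)
    ultimately show ?thesis by (simp add: G'_apply)
  qed
  have G'1: "\<langle>G' (f' j), f j\<rangle> = h j * (1 + c * S (Suc j)) / (1 + c * S j)" if "j < ?n" for j
  proof -
    have "\<langle>G' (f' j), f j\<rangle> = h j + d j * t j"
    proof -
      have "\<langle>G (f' j), f j\<rangle> = h j"
        using that by (simp add: f'_def expand Gp h_def)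
      moreover have "c * \<langle>s, f' j\<rangle> * \<langle>s, f j\<rangle> = d j * t j"
        using that by (simp add: cs t_def)
      ultimately show ?thesis by (simp add: G'_apply)
    qed
    also have "\<dots> = h j * (1 + c * S (Suc j)) / (1 + c * S j)"
    proof -
      have "S (Suc j) = S j + (t j)\<^sup>2 / h j" by (simp add: S_def)
      moreover have "1 + c * S j \<noteq> 0" "h j \<noteq> 0" using S1[of j] that h[of j] by auto
      ultimately show ?thesis
        by (simp add: d_def divide_simps) (simp add: algebra_simps power2_eq_square)
    qed
    finally show ?thesis .
  qed
  have diff: "f' j - f j \<in> span (f ` {..<j})" for j
    unfolding f'_def p_def
    by (simp, intro span_neg span_mul span_sum span_base) auto
  have span_eq: "span (f' ` {..<j}) = span (f ` {..<j})" for j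
  proof (induction j)
    case (Suc j)
    have "span (f' ` {..<Suc j}) = span (insert (f' j) (f' ` {..<j}))" by (simp add: lessThan_Suc)
    also have "\<dots> = span (insert (f' j) (f ` {..<j}))" by (simp add: span_insert Suc)
    also have "\<dots> = span (insert (f j) (f ` {..<j}))" by (rule eq_span_insert_eq[OF diff])
    finally show ?case by (simp add: lessThan_Suc)
  qed simp
  \<comment> \<open>Orthogonality to the old vectors passes to their span, which contains
    \<open>f' j - f j\<close> and all earlier \<open>f' i\<close>. This settles both the diagonal
    entries and the conjugacy of the new basis.\<close>
  have G'_span: "\<langle>G' (f' j), v\<rangle> = 0" if "v \<in> span (f ` {..<j})" "j < ?n" for j v
  proof -
    have "\<langle>G' (f' j), v\<rangle> = \<langle>0, v\<rangle>"
      using that(1)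
    proof (rule linear_eq_on[rotated 2])
      show "\<langle>G' (f' j), b\<rangle> = \<langle>0, b\<rangle>" if "b \<in> f ` {..<j}" for b
        using that \<open>j < ?n\<close> G'0 by auto
    qed (intro bounded_linear.linear blinfun.bounded_linear_right)+
    then show ?thesis by simp
  qed
  have G'_diag: "\<langle>G' (f' j), f' j\<rangle> = h j * (1 + c * S (Suc j)) / (1 + c * S j)" if "j < ?n" for j
    using G'_span[OF diff that] G'1[OF that] by (simp add: blinfun.diff_right)
  have G'_lt: "\<langle>G' (f' j), f' i\<rangle> = 0" if "i < j" "j < ?n" for i j
  proof (rule G'_span[OF _ that(2)])
    have "f' i \<in> span (f' ` {..<j})" using that by (intro span_base) auto
    then show "f' i \<in> span (f ` {..<j})" by (simp add: span_eq)
  qed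
  have "f' i \<noteq> 0" if "i < ?n" for i
  proof
    assume "f' i = 0"
    then have "h i * (1 + c * S (Suc i)) / (1 + c * S i) = 0" using G'_diag[OF that] by simp
    moreover have "h i * (1 + c * S (Suc i)) / (1 + c * S i) > 0"
      using h[OF that] S1[of i] S1[of "Suc i"] that by simp
    ultimately show False by linarith
  qed
  moreover have "\<langle>G' (f' i), f' j\<rangle> = 0" if "i < ?n" "j < ?n" "i \<noteq> j" for i j
    using that G'_lt[of i j] G'_lt[of j i] G'.sym[of "f' i" "f' j"] by (cases i j rule: linorder_cases) auto
  ultimately have basis: "conjugate_basis G' f'"
    using f span_eq[of ?n] by (auto simp: conjugate_basis_def)
  \<comment> \<open>The product of the new diagonal entries telescopes, starting from
    \<open>S 0 = 0\<close>.\<close>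
  have "(\<Prod>j<m. h j * (1 + c * S (Suc j)) / (1 + c * S j)) = (1 + c * S m) * (\<Prod>j<m. h j)"
    if "m \<le> ?n" for m
    using that
  proof (induction m)
    case (Suc m)
    then show ?case using S1[of m] by (simp add: field_simps)
  qed (simp add: S_def)
  from this[of ?n] have "gram_det G' f' = (1 + c * S ?n) * gram_det G f"
    by (simp add: gram_det_def G'_diag h_def)
  also have "S ?n = (op_dual_norm G s)\<^sup>2"
    by (simp add: op_dual_norm_sq_expansion[OF f] S_def t_def h_def)
  finally show ?thesis
    using that[OF basis[unfolded G'_def]] diff span_eq by (simp add: G'_def)
qed

end

section \<open>Determinant against trace along a sequence of rank-one updates\<close>

locale rank_one_sequence = pos_def_operator B for B :: "'a::euclidean_space \<Rightarrow> 'a dual" +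
  fixes G :: "nat \<Rightarrow> 'a \<Rightarrow> 'a dual" and b :: "nat \<Rightarrow> real" and g :: "nat \<Rightarrow> 'a dual"
  assumes G_0: "G 0 = B" and G_Suc: "G (Suc k) = (\<lambda>y. G k y + b k *\<^sub>R rank_one (g k) y)"
    and b_nonneg: "b k \<ge> 0"
begin

lemma pos_def: "pos_def_operator (G k)"
proof (induction k)
  case 0
  then show ?case by (simp add: G_0 pos_def_operator_axioms)
next
  case (Suc k)
  then show ?case
    unfolding G_Suc using b_nonneg by (rule pos_def_operator.rank_one_update_pos_def)
qed

lemma G_diagonal: "\<langle>G k y, y\<rangle> = \<langle>B y, y\<rangle> + (\<Sum>i<k. b i * \<langle>g i, y\<rangle>\<^sup>2)"
  by (induction k)
    (auto simp: G_0 G_Suc rank_one_def blinfun.add_left blinfun.scaleR_left power2_eq_square)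

lemma B_le_G: "\<langle>B y, y\<rangle> \<le> \<langle>G k y, y\<rangle>"
  unfolding G_diagonal using b_nonneg by (simp add: sum_nonneg)

lemma op_dual_norm_le: "op_dual_norm (G k) s \<le> op_dual_norm B s"
  by (rule pos_def_operator.op_dual_norm_antimono[OF pos_def pos_def_operator_axioms B_le_G])

text \<open>Each update contributes one factor to the determinant and changes the basis by a unit
  triangular map. Spans of initial segments are preserved, so the differences from the fixed
  \<open>e\<close> accumulate inside them.\<close>

lemma triangular_conjugate_basis:
  assumes "conjugate_basis B e"
  shows "\<exists>f. conjugate_basis (G k) f \<and>
    gram_det (G k) f = (\<Prod>i<k. 1 + b i * (op_dual_norm (G i) (g i))\<^sup>2) * gram_det B e \<and>
    (\<forall>j<DIM('a). f j - e j \<in> span (f ` {..<j}))"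
proof (induction k)
  case 0
  then show ?case using assms by (auto simp: G_0 span_zero intro!: exI[of _ e])
next
  case (Suc k)
  then obtain f where f: "conjugate_basis (G k) f"
    "gram_det (G k) f = (\<Prod>i<k. 1 + b i * (op_dual_norm (G i) (g i))\<^sup>2) * gram_det B e"
    "\<And>j. j < DIM('a) \<Longrightarrow> f j - e j \<in> span (f ` {..<j})" by auto
  obtain f' where f': "conjugate_basis (G (Suc k)) f'"
    "gram_det (G (Suc k)) f' = (1 + b k * (op_dual_norm (G k) (g k))\<^sup>2) * gram_det (G k) f"
    "\<And>j. j < DIM('a) \<Longrightarrow> f' j - f j \<in> span (f ` {..<j})"
    "\<And>j. j \<le> DIM('a) \<Longrightarrow> span (f' ` {..<j}) = span (f ` {..<j})"
    unfolding G_Suc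
    by (rule pos_def_operator.conjugate_basis_rank_one_update[OF pos_def f(1) b_nonneg]) blast
  have "f' j - e j \<in> span (f' ` {..<j})" if "j < DIM('a)" for j
    using span_add[OF f'(3)[OF that] f(3)[OF that]] f'(4)[of j] that by simp
  then show ?case using f'(1,2) f(2) by (intro exI[of _ f']) (simp add: mult_ac)
qed

text \<open>In a \<open>B\<close>-orthonormal basis the diagonal of \<open>G k\<close> sums to the
  trace relative to \<open>B\<close>. Hadamard's inequality bounds the determinant by the product of
  that diagonal, and the inequality of arithmetic and geometric means bounds the product by a power
  of the mean.\<close>

lemma det_le_trace:
  "(\<Prod>i<k. 1 + b i * (op_dual_norm (G i) (g i))\<^sup>2)
    \<le> (1 + (\<Sum>i<k. b i * (op_dual_norm B (g i))\<^sup>2) / DIM('a)) ^ DIM('a)"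
proof -
  let ?n = "DIM('a)"
  obtain e where e: "conjugate_basis B e" and e1: "\<And>i. i < ?n \<Longrightarrow> \<langle>B (e i), e i\<rangle> = 1"
    using orthonormal_basis_exists by blast
  obtain f where f: "conjugate_basis (G k) f"
    "gram_det (G k) f = (\<Prod>i<k. 1 + b i * (op_dual_norm (G i) (g i))\<^sup>2) * gram_det B e"
    "\<And>j. j < ?n \<Longrightarrow> f j - e j \<in> span (f ` {..<j})"
    using triangular_conjugate_basis[OF e, of k] by auto
  define D where "D j = \<langle>G k (e j), e j\<rangle>" for j
  have D0: "D j \<ge> 0" for j
    unfolding D_def by (rule pos_def_operator.nonneg[OF pos_def])
  have "gram_det B e = 1" using e1 by (simp add: gram_det_def)
  then have le: "(\<Prod>i<k. 1 + b i * (op_dual_norm (G i) (g i))\<^sup>2) \<le> (\<Prod>j<?n. D j)"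
    using pos_def_operator.gram_det_le[OF pos_def f(1,3)] f(2) by (simp add: D_def)
  have "(\<Prod>j<?n. D j) \<le> ((\<Sum>j<?n. D j) / ?n) ^ ?n"
  proof -
    have "(\<Prod>j<?n. D j) = ((\<Prod>j<?n. D j) powr (1 / ?n)) ^ ?n"
      using D0 by (simp add: prod_nonneg flip: root_powr_inverse)
    also have "\<dots> \<le> ((\<Sum>j<?n. D j) / ?n) ^ ?n"
      using arith_geom_mean[of "{..<?n}" D] D0
      by (intro power_mono) (auto simp: sum_divide_distrib lessThan_empty_iff)
    finally show ?thesis .
  qed
  also have "(\<Sum>j<?n. D j) = ?n + (\<Sum>i<k. b i * (op_dual_norm B (g i))\<^sup>2)"
  proof -
    have "(\<Sum>j<?n. D j) = (\<Sum>j<?n. 1 + (\<Sum>i<k. b i * \<langle>g i, e j\<rangle>\<^sup>2))"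
      by (intro sum.cong) (auto simp: D_def G_diagonal e1)
    also have "\<dots> = ?n + (\<Sum>i<k. b i * (\<Sum>j<?n. \<langle>g i, e j\<rangle>\<^sup>2))"
      by (simp add: sum.distrib sum_distrib_left sum.swap[of _ "{..<?n}"])
    finally show ?thesis by (simp add: op_dual_norm_sq_expansion[OF e] e1)
  qed
  finally show ?thesis using le by (simp add: add_divide_distrib)
qed

end

section \<open>The constants of the scheme\<close>

text \<open>The difference of the sides vanishes at 0 and has derivative
  \<open>artanh t - t\<close>, because the two terms in \<open>t / (1 - t\<^sup>2)\<close> cancel.
  That derivative is nonnegative by the same monotonicity argument.\<close>

lemma sq_le_artanh:
  fixes y :: real
  assumes "0 \<le> y" "y < 1"
  shows "- ln (1 - y\<^sup>2) / 2 + y\<^sup>2 / 2 \<le> y * artanh y"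
proof -
  have *: "t \<le> artanh t" if "0 \<le> t" "t < 1" for t :: real
  proof -
    have "artanh 0 - 0 \<le> artanh t - t"
    proof (rule DERIV_nonneg_imp_nondecreasing[OF that(1)])
      fix u :: real assume u: "0 \<le> u" "u \<le> t"
      then have "u\<^sup>2 < 1" using that by (simp add: abs_square_less_1)
      then have "1 / (1 - u\<^sup>2) - 1 \<ge> 0" by (simp add: field_simps)
      moreover have "((\<lambda>u. artanh u - u) has_real_derivative (1 / (1 - u\<^sup>2) - 1)) (at u)"
        using u that by (auto intro!: derivative_eq_intros)
      ultimately show "\<exists>D. ((\<lambda>u. artanh u - u) has_real_derivative D) (at u) \<and> D \<ge> 0" by blast
    qed
    then show ?thesis by simp
  qed
  let ?f = "\<lambda>t. t * artanh t + ln (1 - t\<^sup>2) / 2 - t\<^sup>2 / 2"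
  have "?f 0 \<le> ?f y"
  proof (rule DERIV_nonneg_imp_nondecreasing[OF assms(1)])
    fix t :: real assume t: "0 \<le> t" "t \<le> y"
    then have t1: "t\<^sup>2 < 1" using assms by (simp add: abs_square_less_1)
    have "(?f has_real_derivative
        artanh t + t * (1 / (1 - t\<^sup>2)) + (- (2 * t)) / (1 - t\<^sup>2) / 2 - t) (at t)"
      using t t1 assms
      by (auto intro!: derivative_eq_intros simp: divide_simps) (simp add: algebra_simps)
    moreover have "artanh t + t * (1 / d) + (- (2 * t)) / d / 2 - t = artanh t - t" for d
      by simp
    ultimately have "(?f has_real_derivative artanh t - t) (at t)" by (simp only:)
    then show "\<exists>D. (?f has_real_derivative D) (at t) \<and> D \<ge> 0" using *[of t] t assms by auto
  qed
  then show ?thesis by simp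
qed

lemma theta_const_cube: "(1 + theta_const) ^ 3 = 2"
  by (simp add: theta_const_def)

text \<open>The lower bound yields the 9/20 of \<open>sqrt_theta_ratio\<close> and the constant 6 of
  the exponential rate; the upper one ensures \<open>\<theta> / 2 \<le> \<alpha> 0\<close>.\<close>

lemma theta_const_bounds: "theta_const \<ge> 2599 / 10000" "theta_const \<le> 13 / 50"
proof -
  have "root 3 ((12599 / 10000::real) ^ 3) \<le> root 3 2" by (intro real_root_le_mono) (auto simp: power3_eq_cube)
  then show "theta_const \<ge> 2599 / 10000" by (simp add: theta_const_def real_root_power_cancel)
  have "root 3 2 \<le> root 3 ((63 / 50 ::real) ^ 3)" by (intro real_root_le_mono) (auto simp: power3_eq_cube)
  then show "theta_const \<le> 13 / 50" by (simp add: theta_const_def real_root_power_cancel)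
qed

lemma sqrt_theta_ratio: "sqrt (theta_const / (theta_const + 1)) \<ge> 9 / 20"
proof (rule real_le_rsqrt)
  show "(9 / 20)\<^sup>2 \<le> theta_const / (theta_const + 1)"
    using theta_const_bounds by (simp add: field_simps power2_eq_square)
qed

text \<open>The factor by which \<open>(r k)\<^sup>2\<close> grows in one step, up to an additive
  term; see \<open>r_Suc_le\<close>.\<close>

definition growth_rate :: "real \<Rightarrow> real"
  where "growth_rate \<gamma> = 1 + \<gamma>\<^sup>2 / (2 * (1 + \<gamma>))"

context
  fixes n :: nat
  assumes n: "n \<ge> 1"
begin

text \<open>With \<open>p = sqrt (2 * n - 1)\<close> and \<open>q = sqrt (2 * n + 1)\<close> the
  denominator of \<open>gamma_const n\<close> is \<open>p * (p + q)\<close>, and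
  \<open>q\<^sup>2 - p\<^sup>2 = 2\<close> turns the quotient into
  \<open>(q - p) / p\<close>.\<close>

lemma one_plus_gamma_const: "1 + gamma_const n = sqrt ((2 * real n + 1) / (2 * real n - 1))"
proof -
  define p where "p = sqrt (2 * real n - 1)"
  define q where "q = sqrt (2 * real n + 1)"
  have p: "p > 0" "p * p = 2 * real n - 1" and q: "q > 0" "q * q = 2 * real n + 1"
    using n by (simp_all add: p_def q_def)
  have "sqrt (4 * (real n)\<^sup>2 - 1) = p * q"
    unfolding p_def q_def real_sqrt_mult[symmetric] by (simp add: algebra_simps power2_eq_square)
  then have "gamma_const n = 2 / (p * q + p * p)"
    by (simp add: gamma_const_def p(2))
  also have "\<dots> = q / p - 1"
  proof -
    have "p * q + p * p > 0" using p(1) q(1) by (simp add: add_pos_pos)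
    moreover have "(q - p) * (q + p) = 2" using p(2) q(2) by (simp add: algebra_simps)
    ultimately show ?thesis using p(1) by (simp add: field_simps)
  qed
  finally show ?thesis by (simp add: p_def q_def real_sqrt_divide)
qed

lemma gamma_const_pos: "gamma_const n > 0"
proof -
  have "sqrt ((2 * real n + 1) / (2 * real n - 1)) > sqrt 1"
    using n by (intro real_sqrt_less_mono) (simp add: field_simps)
  then have "1 + gamma_const n > 1" by (simp only: one_plus_gamma_const real_sqrt_one)
  then show ?thesis by simp
qed

text \<open>Used in the form \<open>\<gamma> / n \<le> 2 * \<gamma>\<^sup>2\<close>, which replaces
  \<open>sqrt (\<gamma> / n)\<close> by \<open>sqrt 2 * \<gamma>\<close>.\<close>

lemma n_gamma_const: "real n * gamma_const n \<ge> 1 / 2"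
proof -
  have "sqrt (4 * (real n)\<^sup>2 - 1) \<le> sqrt ((2 * real n)\<^sup>2)"
    by (intro real_sqrt_le_mono) (simp add: power2_eq_square)
  then have "sqrt (4 * (real n)\<^sup>2 - 1) + 2 * real n - 1 \<le> 4 * real n"
    unfolding real_sqrt_abs by linarith
  moreover have "sqrt (4 * (real n)\<^sup>2 - 1) \<ge> 0"
  proof -
    have "(real n)\<^sup>2 \<ge> 1" using n by simp
    then show ?thesis by (intro real_sqrt_ge_zero) linarith
  qed
  then have "sqrt (4 * (real n)\<^sup>2 - 1) + 2 * real n - 1 > 0" using n by linarith
  ultimately show ?thesis by (simp add: gamma_const_def field_simps)
qed

text \<open>Since \<open>1 + \<gamma> = q / p\<close>, the rate is
  \<open>(p\<^sup>2 + q\<^sup>2) / (2 * p * q)\<close>, where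
  \<open>p\<^sup>2 + q\<^sup>2 = 4 * n\<close>.\<close>

lemma growth_rate_gamma_const: "growth_rate (gamma_const n) = 1 / sqrt (1 - (1 / (2 * real n))\<^sup>2)"
proof -
  define p where "p = sqrt (2 * real n - 1)"
  define q where "q = sqrt (2 * real n + 1)"
  have p: "p > 0" "p\<^sup>2 = 2 * real n - 1" and q: "q > 0" "q\<^sup>2 = 2 * real n + 1"
    using n by (simp_all add: p_def q_def)
  have g: "1 + gamma_const n = q / p" "gamma_const n = q / p - 1"
    using one_plus_gamma_const by (simp_all add: p_def q_def real_sqrt_divide)
  have "growth_rate (gamma_const n) = (p\<^sup>2 + q\<^sup>2) / (2 * p * q)"
    unfolding growth_rate_def g(1) unfolding g(2) using p(1) q(1)
    by (simp add: field_simps power2_eq_square)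
  also have "\<dots> = 2 * real n / (p * q)" by (simp add: p(2) q(2))
  also have "p * q = sqrt ((2 * real n)\<^sup>2 * (1 - (1 / (2 * real n))\<^sup>2))"
    unfolding p_def q_def real_sqrt_mult[symmetric] using n
    by (simp add: field_simps power2_eq_square)
  also have "\<dots> = 2 * real n * sqrt (1 - (1 / (2 * real n))\<^sup>2)"
    by (simp only: real_sqrt_mult real_sqrt_abs)
  finally show ?thesis using n by simp
qed

lemma growth_rate_ge_1: "growth_rate (gamma_const n) \<ge> 1"
  using gamma_const_pos by (simp add: growth_rate_def)

text \<open>The balance of a single step: the growth of the radius bound, times the decay still to
  be gained, is paid for by the growth of the lower bound on the weights.\<close>

lemma growth_rate_le:
  "growth_rate (gamma_const n) * exp (1 / (8 * (real n)\<^sup>2)) \<le> (1 + gamma_const n) powr (1 / (2 * real n))"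
proof -
  define y where "y = 1 / (2 * real n)"
  have y: "0 < y" "y < 1" using n by (auto simp: y_def field_simps)
  then have y2: "y\<^sup>2 < 1" by (simp add: abs_square_less_1)
  have "(2 * real n + 1) / (2 * real n - 1) = (1 + y) / (1 - y)"
    using n by (simp add: y_def field_simps)
  then have "ln (1 + gamma_const n) = artanh y"
    using y by (simp add: one_plus_gamma_const ln_sqrt artanh_def)
  moreover have "ln (growth_rate (gamma_const n)) = - ln (1 - y\<^sup>2) / 2"
    using y2 by (simp add: growth_rate_gamma_const ln_div ln_sqrt y_def[symmetric])
  moreover have "1 / (8 * (real n)\<^sup>2) = y\<^sup>2 / 2" by (simp add: y_def power2_eq_square)
  ultimately have "ln (growth_rate (gamma_const n)) + 1 / (8 * (real n)\<^sup>2)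
      \<le> 1 / (2 * real n) * ln (1 + gamma_const n)"
    using sq_le_artanh[of y] y by (simp add: y_def[symmetric])
  then have "exp (ln (growth_rate (gamma_const n)) + 1 / (8 * (real n)\<^sup>2))
      \<le> exp (1 / (2 * real n) * ln (1 + gamma_const n))" by simp
  then show ?thesis
    using growth_rate_ge_1 gamma_const_pos by (simp add: exp_add powr_def)
qed

text \<open>The rate is \<open>sqrt (1 + t) \<le> exp (t / 2)\<close>, and
  \<open>n\<^sup>2 * t \<le> 1 / 3\<close>, so the power stays below \<open>exp (1 / 6)\<close>. The
  looser 9/5 is what the linear weight bound can afford: 9/5 divided by twice 9/20 is 2.\<close>

lemma growth_rate_power_le:
  assumes "k \<le> n\<^sup>2"
  shows "growth_rate (gamma_const n) ^ k \<le> 9 / 5"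
proof -
  define t where "t = 1 / (4 * (real n)\<^sup>2 - 1)"
  have n2: "(real n)\<^sup>2 \<ge> 1" using n by simp
  have t: "t > 0" using n2 by (simp add: t_def)
  have "growth_rate (gamma_const n) = sqrt (1 + t)"
  proof -
    have "1 / (1 - (1 / (2 * real n))\<^sup>2) = 4 * (real n)\<^sup>2 / (4 * (real n)\<^sup>2 - 1)"
      using n by (simp add: power_divide power_mult_distrib field_simps)
    also have "\<dots> = 1 + t"
      using n2 by (simp add: t_def divide_simps del: one_le_power)
    finally have "1 / (1 - (1 / (2 * real n))\<^sup>2) = 1 + t" .
    then show ?thesis unfolding growth_rate_gamma_const by (metis real_sqrt_divide real_sqrt_one)
  qed
  also have "\<dots> \<le> exp (t / 2)"
  proof (rule real_le_lsqrt)
    show "1 + t \<le> (exp (t / 2))\<^sup>2" using exp_ge_add_one_self[of t] by (simp flip: exp_double)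
  qed auto
  finally have "growth_rate (gamma_const n) ^ n\<^sup>2 \<le> exp (t / 2) ^ n\<^sup>2"
    using growth_rate_ge_1 by (intro power_mono) auto
  also have "\<dots> = exp ((real n)\<^sup>2 * t / 2)" by (simp flip: exp_of_nat_mult)
  also have "\<dots> \<le> exp (1 / 6)"
    using n2 by (simp add: t_def field_simps)
  also have "\<dots> \<le> 1 + 1/6 + (1/6)\<^sup>2" by (rule exp_bound) auto
  also have "\<dots> \<le> (9 / 5 :: real)" by (simp add: power2_eq_square)
  finally show ?thesis
    using power_increasing[OF assms growth_rate_ge_1] by linarith
qed

end

section \<open>Quadratic models\<close>

lemma max_over_attained:
  fixes f :: "'b::topological_space \<Rightarrow> real"
  assumes "compact S" "S \<noteq> {}" "continuous_on S f"
  obtains y where "y \<in> S" "max_over S f = f y" "\<And>z. z \<in> S \<Longrightarrow> f z \<le> f y"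
proof -
  obtain y where y: "y \<in> S" "\<And>z. z \<in> S \<Longrightarrow> f z \<le> f y"
    using continuous_attains_sup[OF assms] by blast
  have "max_over S f = f y"
    unfolding max_over_def by (rule Greatest_equality) (use y in auto)
  then show ?thesis using y that by blast
qed

context pos_def_operator
begin

text \<open>Positive definiteness makes \<open>z\<close> the only minimizer, so the choice operator
  has to return it.\<close>

lemma arg_min_on_quadratic: "arg_min_on (\<lambda>y. K + 1/2 * \<langle>G (y - z), y - z\<rangle>) UNIV = z"
proof -
  have *: "is_arg_min (\<lambda>y. K + 1/2 * \<langle>G (y - z), y - z\<rangle>) (\<lambda>y. y \<in> UNIV) u \<longleftrightarrow> u = z" for u
  proof
    assume "is_arg_min (\<lambda>y. K + 1/2 * \<langle>G (y - z), y - z\<rangle>) (\<lambda>y. y \<in> UNIV) u"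
    then have "\<not> K + 1/2 * \<langle>G (z - z), z - z\<rangle> < K + 1/2 * \<langle>G (u - z), u - z\<rangle>"
      unfolding is_arg_min_def by blast
    then show "u = z" using pos[of "u - z"] by (cases "u = z") (auto simp: linear_simps)
  next
    assume "u = z"
    then show "is_arg_min (\<lambda>y. K + 1/2 * \<langle>G (y - z), y - z\<rangle>) (\<lambda>y. y \<in> UNIV) u"
      using nonneg by (auto simp: is_arg_min_def linear_0[OF linear] not_less)
  qed
  show ?thesis
    unfolding arg_min_on_def arg_min_def by (rule some_equality) (simp_all only: *)
qed

lemma complete_square:
  "1/2 * \<langle>G h, h\<rangle> + c * \<langle>s, h\<rangle>
    = 1/2 * \<langle>G (h + c *\<^sub>R inv G s), h + c *\<^sub>R inv G s\<rangle> - 1/2 * c\<^sup>2 * (op_dual_norm G s)\<^sup>2"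
  using sym[of h "inv G s"]
  unfolding op_dual_norm_sq by (simp add: expand power2_eq_square algebra_simps)

text \<open>Sherman-Morrison at \<open>s\<close> itself: the updated operator maps
  \<open>inv G s\<close> to \<open>(1 + c * N) *\<^sub>R s\<close>. It identifies the quotient in
  \<open>radius_sequence\<close> as a squared dual norm for the next Hessian.\<close>

lemma op_dual_norm_rank_one_update:
  assumes "c \<ge> 0"
  shows "(op_dual_norm (\<lambda>y. G y + c *\<^sub>R rank_one s y) s)\<^sup>2
    = (op_dual_norm G s)\<^sup>2 / (1 + c * (op_dual_norm G s)\<^sup>2)"
proof -
  define N where "N = (op_dual_norm G s)\<^sup>2"
  interpret G': pos_def_operator "\<lambda>y. G y + c *\<^sub>R rank_one s y"
    by (rule rank_one_update_pos_def[OF assms])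
  have N: "1 + c * N > 0" using assms by (simp add: N_def add_pos_nonneg)
  have "G (inv G s /\<^sub>R (1 + c * N)) + c *\<^sub>R rank_one s (inv G s /\<^sub>R (1 + c * N))
      = ((1 + c * N) / (1 + c * N)) *\<^sub>R s"
    unfolding add_divide_distrib
    by (simp add: linear_simps rank_one_def blinfun.scaleR_right divide_inverse mult_ac
        scaleR_left_distrib flip: op_dual_norm_sq N_def)
  then have "inv (\<lambda>y. G y + c *\<^sub>R rank_one s y) s = inv G s /\<^sub>R (1 + c * N)"
    using N by (intro inv_f_eq[OF G'.injective]) simp
  then show ?thesis
    unfolding G'.op_dual_norm_sq
    by (simp add: blinfun.scaleR_right divide_inverse mult.commute flip: op_dual_norm_sq N_def)
qed

lemma continuous_on_quadratic: "continuous_on S (\<lambda>y. \<langle>G (y - z), y - z\<rangle>)"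
proof -
  have "continuous_on S (\<lambda>y. G (y - z))"
    using linear linear_conv_bounded_linear
    by (intro bounded_linear.continuous_on[of G] continuous_intros) auto
  then show ?thesis by (intro continuous_intros)
qed

text \<open>A coercive quadratic outgrows an affine function. The set has this shape because
  \<open>w k\<close> is a quadratic minus the affine \<open>l k\<close>.\<close>

lemma compact_quadratic_sublevel: "compact {y. 1/2 * \<langle>G (y - z), y - z\<rangle> \<le> \<langle>s, y\<rangle> + K}"
proof -
  obtain c where c: "c > 0" "\<And>x. c * (norm x)\<^sup>2 \<le> \<langle>G x, x\<rangle>" using coercive by blast
  \<comment> \<open>Outside the unit ball around \<open>z\<close> the constant term is absorbed into
    a multiple of \<open>norm (y - z)\<close>, so \<open>M\<close> bounds the slope of the affine
    side.\<close>
  define M where "M = norm s + \<bar>\<langle>s, z\<rangle> + K\<bar>"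
  have "norm (y - z) \<le> max 1 (2 * M / c)" if "1/2 * \<langle>G (y - z), y - z\<rangle> \<le> \<langle>s, y\<rangle> + K" for y
  proof (cases "norm (y - z) \<le> 1")
    case False
    then have "c / 2 * norm (y - z) * norm (y - z) \<le> \<langle>s, y\<rangle> + K"
      using c(2)[of "y - z"] that by (simp add: power2_eq_square)
    also have "\<dots> = \<langle>s, y - z\<rangle> + (\<langle>s, z\<rangle> + K)" by (simp add: blinfun.diff_right)
    also have "\<dots> \<le> norm s * norm (y - z) + \<bar>\<langle>s, z\<rangle> + K\<bar> * norm (y - z)"
    proof (rule add_mono)
      show "\<langle>s, y - z\<rangle> \<le> norm s * norm (y - z)"
        using norm_blinfun[of s "y - z"] by simp
      have "\<bar>\<langle>s, z\<rangle> + K\<bar> * 1 \<le> \<bar>\<langle>s, z\<rangle> + K\<bar> * norm (y - z)"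
        using False by (intro mult_left_mono) auto
      then show "\<langle>s, z\<rangle> + K \<le> \<bar>\<langle>s, z\<rangle> + K\<bar> * norm (y - z)"
        unfolding mult_1_right by (rule order_trans[OF abs_ge_self])
    qed
    also have "\<dots> = M * norm (y - z)" by (simp add: M_def algebra_simps)
    finally have "c / 2 * norm (y - z) \<le> M" using False by (simp only: mult_le_cancel_right)
    then have "norm (y - z) \<le> 2 * M / c" using c(1) by (simp add: field_simps)
    then show ?thesis by simp
  qed simp
  then have "bounded {y. 1/2 * \<langle>G (y - z), y - z\<rangle> \<le> \<langle>s, y\<rangle> + K}"
    by (intro bounded_subset[OF bounded_cball[of z "max 1 (2 * M / c)"]])
      (auto simp: dist_norm norm_minus_commute)
  moreover have "closed {y. 1/2 * \<langle>G (y - z), y - z\<rangle> \<le> \<langle>s, y\<rangle> + K}"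
    by (intro closed_Collect_le continuous_intros continuous_on_quadratic)
  ultimately show ?thesis by (simp add: compact_eq_bounded_closed)
qed

end

section \<open>The scheme\<close>

locale scheme_run = pos_def_operator B
  for B :: "'a::euclidean_space \<Rightarrow> 'a dual" +
  fixes orc :: "'a \<Rightarrow> 'a dual" and x0 xs :: 'a and R :: real and a b U r :: "nat \<Rightarrow> real"
    and x :: "nat \<Rightarrow> 'a" and g :: "nat \<Rightarrow> 'a dual" and l w :: "nat \<Rightarrow> 'a \<Rightarrow> real"
    and G :: "nat \<Rightarrow> 'a \<Rightarrow> 'a dual"
  assumes R_pos: "R > 0"
    and xs_ball: "xs \<in> op_ball B x0 R" and xs_solution: "\<langle>orc y, y - xs\<rangle> \<ge> 0"
    and scheme: "general_scheme B orc x0 R a b x g U l w"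
    and hessian: "hessian_sequence B b g G"
    and radius: "radius_sequence R a b g U G r"
begin

lemma scheme_0: "x 0 = x0" "l 0 = (\<lambda>y. 0)" "w 0 = (\<lambda>y. 1/2 * (op_norm B (y - x0))\<^sup>2)"
  and coeff_nonneg: "a k \<ge> 0" "b k \<ge> 0"
  and g_eq: "g k = orc (x k)"
  and U_eq: "U k = max_over (Omega_set R (w k) \<inter> L_minus (l k)) (\<lambda>y. \<langle>g k, x k - y\<rangle>)"
  and l_Suc: "l (Suc k) = (\<lambda>y. l k y + a k * \<langle>g k, y - x k\<rangle>)"
  and w_Suc: "w (Suc k) = (\<lambda>y. w k y
        + 1/2 * b k * (U k - \<langle>g k, x k - y\<rangle>) * \<langle>g k, y - x k\<rangle>)"
  and x_Suc: "x (Suc k) = arg_min_on (\<lambda>y. l (Suc k) y + w (Suc k) y) UNIV"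
  using scheme unfolding general_scheme_def by blast+

sublocale rank_one_sequence B G b g
  by unfold_locales (use hessian coeff_nonneg in \<open>auto simp: hessian_sequence_def\<close>)

lemma r_0: "r 0 = R"
  and r_pos: "r k > 0"
  and r_Suc: "(r (Suc k))\<^sup>2 = (r k)\<^sup>2 + (a k + 1/2 * b k * U k)\<^sup>2 *
        ((op_dual_norm (G k) (g k))\<^sup>2 / (1 + b k * (op_dual_norm (G k) (g k))\<^sup>2))"
  using radius unfolding radius_sequence_def by blast+

lemma op_norm_B_sq: "(op_norm B y)\<^sup>2 = \<langle>B y, y\<rangle>"
  using nonneg by (simp add: op_norm_def)

text \<open>With \<open>h = y - x k\<close>, one step adds
  \<open>c * \<langle>g k, h\<rangle>\<close> and half of
  \<open>b k * \<langle>g k, h\<rangle>\<^sup>2\<close>. The square turns \<open>G k\<close> into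
  \<open>G (Suc k)\<close>; completing the square moves the minimizer and lowers the minimum by half
  of \<open>c\<^sup>2 * N\<close>, which is the recursion of \<open>r\<close>.\<close>

lemma potential: "l k y + w k y = 1/2 * (R\<^sup>2 - (r k)\<^sup>2) + 1/2 * \<langle>G k (y - x k), y - x k\<rangle>"
proof (induction k arbitrary: y)
  case 0
  show ?case by (simp add: scheme_0 G_0 r_0 op_norm_B_sq)
next
  case (Suc k)
  interpret G': pos_def_operator "G (Suc k)" by (rule pos_def)
  define c where "c = a k + 1/2 * b k * U k"
  define N where "N = (op_dual_norm (G (Suc k)) (g k))\<^sup>2"
  define z where "z = x k - c *\<^sub>R inv (G (Suc k)) (g k)"
  have r': "(r (Suc k))\<^sup>2 = (r k)\<^sup>2 + c\<^sup>2 * N"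
    unfolding r_Suc N_def G_Suc c_def
    by (subst pos_def_operator.op_dual_norm_rank_one_update[OF pos_def b_nonneg]) simp
  have step: "l (Suc k) y + w (Suc k) y
      = 1/2 * (R\<^sup>2 - (r (Suc k))\<^sup>2) + 1/2 * \<langle>G (Suc k) (y - z), y - z\<rangle>" for y
  proof -
    define h where "h = y - x k"
    have xy: "\<langle>g k, x k - y\<rangle> = - \<langle>g k, h\<rangle>" by (simp add: h_def blinfun.diff_right)
    have "l (Suc k) y + w (Suc k) y
        = (l k y + w k y) + c * \<langle>g k, h\<rangle> + 1/2 * b k * \<langle>g k, h\<rangle>\<^sup>2"
      unfolding l_Suc w_Suc xy
      by (simp add: c_def algebra_simps power2_eq_square flip: h_def)
    also have "\<dots> = 1/2 * (R\<^sup>2 - (r k)\<^sup>2) + (1/2 * \<langle>G (Suc k) h, h\<rangle> + c * \<langle>g k, h\<rangle>)"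
      unfolding Suc
      by (simp add: G_Suc rank_one_def blinfun.add_left blinfun.scaleR_left power2_eq_square
          algebra_simps flip: h_def)
    also have "\<dots> = 1/2 * (R\<^sup>2 - (r (Suc k))\<^sup>2) + 1/2 * \<langle>G (Suc k) (y - z), y - z\<rangle>"
      unfolding G'.complete_square r'
      by (simp add: N_def h_def z_def algebra_simps)
    finally show ?thesis .
  qed
  have "x (Suc k) = z"
    unfolding x_Suc step by (rule G'.arg_min_on_quadratic)
  then show ?case using step by simp
qed

section \<open>Compactness of the localizers and attainment of the maxima\<close>

lemma l_affine: "\<exists>s K. \<forall>y. l k y = \<langle>s, y\<rangle> + K"
proof (induction k)
  case 0
  show ?case by (auto simp: scheme_0 intro!: exI[of _ 0])
next
  case (Suc k)
  then obtain s K where sK: "\<And>y. l k y = \<langle>s, y\<rangle> + K" by blast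
  show ?case
    by (rule exI[of _ "s + a k *\<^sub>R g k"], rule exI[of _ "K - a k * \<langle>g k, x k\<rangle>"])
      (simp add: l_Suc sK blinfun.add_left blinfun.scaleR_left blinfun.diff_right algebra_simps)
qed

lemma compact_Omega: "compact (Omega_set R (w k))"
proof -
  obtain s K where sK: "\<And>y. l k y = \<langle>s, y\<rangle> + K" using l_affine by blast
  have "Omega_set R (w k)
      = {y. 1/2 * \<langle>G k (y - x k), y - x k\<rangle> \<le> \<langle>s, y\<rangle> + (K + 1/2 * (r k)\<^sup>2)}"
    unfolding Omega_set_def
  proof (rule Collect_cong)
    show "w k y \<le> 1/2 * R\<^sup>2
        \<longleftrightarrow> 1/2 * \<langle>G k (y - x k), y - x k\<rangle> \<le> \<langle>s, y\<rangle> + (K + 1/2 * (r k)\<^sup>2)" for y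
      using potential[of k y] sK[of y] by (simp add: algebra_simps) linarith
  qed
  then show ?thesis
    by (simp only: pos_def_operator.compact_quadratic_sublevel[OF pos_def])
qed

lemma continuous_on_l: "continuous_on S (l k)"
proof -
  obtain s K where "\<And>y. l k y = \<langle>s, y\<rangle> + K" using l_affine by blast
  then have "l k = (\<lambda>y. \<langle>s, y\<rangle> + K)" by blast
  then show ?thesis by (simp, intro continuous_intros)
qed

lemma compact_localizer: "compact (Omega_set R (w k) \<inter> L_minus (l k))"
  unfolding L_minus_def
  by (intro compact_Int_closed compact_Omega closed_Collect_le continuous_on_l continuous_intros)

lemma U_attained:
  assumes "Omega_set R (w k) \<inter> L_minus (l k) \<noteq> {}"
  obtains y where "y \<in> Omega_set R (w k) \<inter> L_minus (l k)" "U k = \<langle>g k, x k - y\<rangle>"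
    "\<And>z. z \<in> Omega_set R (w k) \<inter> L_minus (l k) \<Longrightarrow> \<langle>g k, x k - z\<rangle> \<le> U k"
proof -
  have "continuous_on (Omega_set R (w k) \<inter> L_minus (l k)) (\<lambda>y. \<langle>g k, x k - y\<rangle>)"
    by (intro continuous_intros)
  from max_over_attained[OF compact_localizer assms this] that show ?thesis
    unfolding U_eq by metis
qed

lemma xs_gap_nonneg: "\<langle>g k, x k - xs\<rangle> \<ge> 0"
  using xs_solution by (simp add: g_eq)

text \<open>At \<open>xs\<close> the value \<open>v\<close> satisfies
  \<open>0 \<le> v \<le> U k\<close>, the upper bound because \<open>xs\<close> belongs to the set
  over which \<open>U k\<close> is the maximum. Hence neither update increases \<open>l\<close> or
  \<open>w\<close> there. The lemma also supplies the nonemptiness needed for attainment.\<close>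

lemma xs_localized: "xs \<in> Omega_set R (w k) \<inter> L_minus (l k)"
proof (induction k)
  case 0
  have "op_norm B (xs - x0) \<ge> 0" using nonneg by (simp add: op_norm_def)
  then have "(op_norm B (xs - x0))\<^sup>2 \<le> R\<^sup>2"
    using xs_ball by (intro power_mono) (auto simp: op_ball_def)
  then show ?case by (simp add: Omega_set_def L_minus_def scheme_0)
next
  case (Suc k)
  define v where "v = \<langle>g k, x k - xs\<rangle>"
  have v: "v \<ge> 0" using xs_gap_nonneg by (simp add: v_def)
  have vU: "v \<le> U k"
    using U_attained[of k] Suc unfolding v_def by blast
  have nv: "\<langle>g k, xs - x k\<rangle> = - v" by (simp add: v_def blinfun.diff_right)
  have "l (Suc k) xs = l k xs - a k * v" by (simp add: l_Suc nv)
  moreover have "w (Suc k) xs = w k xs - 1/2 * b k * (U k - v) * v"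
    by (simp add: w_Suc nv flip: v_def)
  moreover have "a k * v \<ge> 0" "1/2 * b k * (U k - v) * v \<ge> 0"
    using coeff_nonneg v vU by (simp_all)
  ultimately show ?case using Suc by (simp add: Omega_set_def L_minus_def)
qed

lemma U_nonneg: "U k \<ge> 0"
  using U_attained[of k] xs_localized[of k] xs_gap_nonneg[of k] by (metis empty_iff order_trans)

text \<open>At a maximizer \<open>l k\<close> is at most 0 and \<open>w k\<close> at most half of
  \<open>R\<^sup>2\<close>, so the potential places it within distance \<open>r k\<close> of
  \<open>x k\<close> in the norm of \<open>G k\<close>; the dual Cauchy-Schwarz inequality does the
  rest.\<close>

lemma U_le: "U k \<le> r k * op_dual_norm (G k) (g k)"
proof -
  interpret G: pos_def_operator "G k" by (rule pos_def)
  obtain y where y: "y \<in> Omega_set R (w k) \<inter> L_minus (l k)" "U k = \<langle>g k, x k - y\<rangle>"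
    using U_attained[of k] xs_localized[of k] by blast
  have "\<langle>G k (y - x k), y - x k\<rangle> \<le> (r k)\<^sup>2"
    using potential[of k y] y(1) by (simp add: Omega_set_def L_minus_def algebra_simps)
  then have "(op_dual_norm (G k) (g k))\<^sup>2 * \<langle>G k (y - x k), y - x k\<rangle>
      \<le> (op_dual_norm (G k) (g k))\<^sup>2 * (r k)\<^sup>2"
    by (rule mult_left_mono) simp
  then have "\<langle>g k, y - x k\<rangle>\<^sup>2 \<le> (r k * op_dual_norm (G k) (g k))\<^sup>2"
    using G.dual_Cauchy_Schwarz[of "g k" "y - x k"] by (simp add: power_mult_distrib mult.commute)
  moreover have "U k = - \<langle>g k, y - x k\<rangle>" by (simp add: y(2) blinfun.diff_right)
  ultimately have "(U k)\<^sup>2 \<le> (r k * op_dual_norm (G k) (g k))\<^sup>2" by simp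
  then show ?thesis
    by (rule power2_le_imp_le) (simp add: r_pos less_imp_le G.op_dual_norm_nonneg)
qed

lemma sliding_gap_le:
  assumes "Gamma_sum B a g k > 0"
  shows "sliding_gap B R a g l w k \<le> (r k)\<^sup>2 / (2 * Gamma_sum B a g k)"
proof -
  let ?\<Gamma> = "Gamma_sum B a g k"
  have "continuous_on (Omega_set R (w k)) (\<lambda>y. 1 / ?\<Gamma> * (- l k y))"
    by (intro continuous_intros continuous_on_l)
  moreover have "Omega_set R (w k) \<noteq> {}" using xs_localized by blast
  ultimately obtain y where y: "y \<in> Omega_set R (w k)"
    "sliding_gap B R a g l w k = 1 / ?\<Gamma> * (- l k y)"
    unfolding sliding_gap_def using max_over_attained[OF compact_Omega] by metis
  have "- l k y \<le> 1/2 * (r k)\<^sup>2"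
    using potential[of k y] y(1) pos_def_operator.nonneg[OF pos_def, of k "y - x k"]
    by (simp add: Omega_set_def algebra_simps)
  then show ?thesis
    unfolding y(2) using assms by (simp add: field_simps)
qed

end

section \<open>The convergence rate\<close>

locale tuned_scheme_run = scheme_run B orc x0 xs R a b U r x g l w G
  for B :: "'a::euclidean_space \<Rightarrow> 'a dual" and orc x0 xs R a b U r x g l w G +
  fixes \<theta> \<gamma> :: real and \<alpha> \<beta> :: "nat \<Rightarrow> real"
  assumes \<theta>: "\<theta> = theta_const" and \<gamma>: "\<gamma> = gamma_const DIM('a)"
    and \<beta>_pos: "\<beta> k > 0" and \<beta>_0: "\<beta> 0 \<ge> 1"
    and \<alpha>: "\<alpha> k = \<beta> k * sqrt (\<theta> / (\<theta> + 1))"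
    and a: "a k = (\<alpha> k * R + 1/2 * \<theta> * \<gamma> * r k) / op_dual_norm (G k) (g k)"
    and b: "b k = \<gamma> / (op_dual_norm (G k) (g k))\<^sup>2"
    and g_nonzero: "g k \<noteq> 0"
begin

lemma dim: "DIM('a) \<ge> 1"
  using DIM_positive[where 'a='a] by linarith

lemma \<theta>_bounds: "\<theta> \<ge> 2599 / 10000" "\<theta> \<le> 13 / 50"
  using theta_const_bounds by (simp_all add: \<theta>)

lemma \<gamma>_pos: "\<gamma> > 0"
  using gamma_const_pos[OF dim] by (simp add: \<gamma>)

lemma \<alpha>_ge: "\<alpha> k \<ge> 9 / 20 * \<beta> k"
  using mult_left_mono[OF sqrt_theta_ratio, of "\<beta> k"] \<beta>_pos[of k] by (simp add: \<alpha> \<theta> mult.commute)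

lemma N_pos: "op_dual_norm (G k) (g k) > 0"
  by (rule pos_def_operator.op_dual_norm_pos[OF pos_def g_nonzero])

lemma b_N_sq: "b k * (op_dual_norm (G k) (g k))\<^sup>2 = \<gamma>"
  using N_pos[of k] by (simp add: b)

lemma r_mono: "r k \<le> r (Suc k)"
proof (rule power2_le_imp_le)
  show "(r k)\<^sup>2 \<le> (r (Suc k))\<^sup>2"
    unfolding r_Suc b_N_sq using \<gamma>_pos by simp
qed (simp add: r_pos less_imp_le)

lemma R_le_r: "R \<le> r k"
  by (induction k) (auto simp: r_0 intro: order_trans[OF _ r_mono])

lemma r_Suc_le: "(r (Suc k))\<^sup>2 \<le> growth_rate \<gamma> * (r k)\<^sup>2 + (\<beta> k)\<^sup>2 * R\<^sup>2"
proof -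
  define N where "N = op_dual_norm (G k) (g k)"
  define u where "u = \<alpha> k * R"
  define v where "v = 1/2 * (1 + \<theta>) * \<gamma> * r k"
  have N: "N > 0" using N_pos by (simp add: N_def)
  have \<theta>0: "\<theta> > 0" using \<theta>_bounds by simp
  have "(a k + 1/2 * b k * U k) * N = u + 1/2 * \<theta> * \<gamma> * r k + 1/2 * \<gamma> * (U k / N)"
    using N by (simp add: a b u_def field_simps power2_eq_square flip: N_def)
  also have "\<dots> \<le> u + 1/2 * \<theta> * \<gamma> * r k + 1/2 * \<gamma> * r k"
    using U_le[of k] N \<gamma>_pos by (simp add: field_simps flip: N_def)
  also have "\<dots> = u + v" by (simp add: v_def algebra_simps)
  finally have "((a k + 1/2 * b k * U k) * N)\<^sup>2 \<le> (u + v)\<^sup>2"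
    using coeff_nonneg U_nonneg N by (intro power_mono mult_nonneg_nonneg add_nonneg_nonneg) auto
  also have "\<dots> \<le> (1 + 1 / \<theta>) * u\<^sup>2 + (1 + \<theta>) * v\<^sup>2"
  proof -
    \<comment> \<open>Young's inequality with weight \<open>\<theta>\<close>. The weight is tuned to
      the coefficients: \<open>\<alpha>\<close> contains the root that cancels
      \<open>1 + 1 / \<theta>\<close>, and the other term carries
      \<open>(1 + \<theta>) ^ 3 = 2\<close>.\<close>
    have "0 \<le> (u - \<theta> * v)\<^sup>2 / \<theta>" using \<theta>0 by simp
    also have "\<dots> = (1 + 1 / \<theta>) * u\<^sup>2 + (1 + \<theta>) * v\<^sup>2 - (u + v)\<^sup>2"
      using \<theta>0 by (simp add: field_simps power2_eq_square)
    finally show ?thesis by simp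
  qed
  also have "(1 + 1 / \<theta>) * u\<^sup>2 = (\<beta> k)\<^sup>2 * R\<^sup>2"
  proof -
    have "u\<^sup>2 = (\<beta> k)\<^sup>2 * R\<^sup>2 * (\<theta> / (\<theta> + 1))"
      using \<theta>0 by (simp add: u_def \<alpha> power_mult_distrib)
    moreover have "(1 + 1 / \<theta>) * (\<theta> / (\<theta> + 1)) = 1" using \<theta>0 by (simp add: divide_simps)
    ultimately show ?thesis by (simp only: mult.left_commute[of "1 + 1 / \<theta>"] mult_1_right)
  qed
  also have "(1 + \<theta>) * v\<^sup>2 = (1 + \<theta>) ^ 3 * \<gamma>\<^sup>2 * (r k)\<^sup>2 / 4"
    by (simp add: v_def power_mult_distrib power2_eq_square power3_eq_cube)
  also have "\<dots> = \<gamma>\<^sup>2 * (r k)\<^sup>2 / 2"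
    by (simp add: \<theta> theta_const_cube)
  finally have "((a k + 1/2 * b k * U k) * N)\<^sup>2 \<le> (\<beta> k)\<^sup>2 * R\<^sup>2 + \<gamma>\<^sup>2 * (r k)\<^sup>2 / 2" .
  then have "((a k + 1/2 * b k * U k) * N)\<^sup>2 / (1 + \<gamma>)
      \<le> ((\<beta> k)\<^sup>2 * R\<^sup>2 + \<gamma>\<^sup>2 * (r k)\<^sup>2 / 2) / (1 + \<gamma>)"
    using \<gamma>_pos by (intro divide_right_mono) auto
  \<comment> \<open>The denominator \<open>1 + \<gamma>\<close> is kept on the \<open>r\<close>
    term, where it forms the growth rate, and dropped on the other.\<close>
  also have "\<dots> \<le> (\<beta> k)\<^sup>2 * R\<^sup>2 + \<gamma>\<^sup>2 / (2 * (1 + \<gamma>)) * (r k)\<^sup>2"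
    using \<gamma>_pos mult_left_mono[of 1 "1 + \<gamma>" "(\<beta> k)\<^sup>2 * R\<^sup>2"]
    by (simp add: add_divide_distrib divide_le_eq)
  finally show ?thesis
    unfolding r_Suc b_N_sq growth_rate_def distrib_right[of 1] power_mult_distrib N_def by simp
qed

lemma r_le: "(r k)\<^sup>2 \<le> growth_rate \<gamma> ^ k * (1 + (\<Sum>i<k. (\<beta> i)\<^sup>2)) * R\<^sup>2"
proof (induction k)
  case (Suc k)
  let ?q = "growth_rate \<gamma>" and ?C = "1 + (\<Sum>i<k. (\<beta> i)\<^sup>2)"
  have q: "?q \<ge> 1" using growth_rate_ge_1[OF dim] by (simp add: \<gamma>)
  have "(r (Suc k))\<^sup>2 \<le> ?q * (?q ^ k * ?C * R\<^sup>2) + 1 * ((\<beta> k)\<^sup>2 * R\<^sup>2)"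
    using r_Suc_le[of k] mult_left_mono[OF Suc, of ?q] q by linarith
  \<comment> \<open>The new summand is inflated by a power of the rate, at least 1, so that this
    power factors out of the whole sum.\<close>
  also have "\<dots> \<le> ?q * (?q ^ k * ?C * R\<^sup>2) + ?q ^ Suc k * ((\<beta> k)\<^sup>2 * R\<^sup>2)"
    using one_le_power[OF q, of "Suc k"] by (intro add_left_mono mult_right_mono) auto
  finally show ?case by (simp add: algebra_simps)
qed (simp add: r_0)

text \<open>The weights in \<open>Gamma_sum\<close> contain the first powers of these ratios, while
  the trace contains their squares, as \<open>b i * (op_dual_norm B (g i))\<^sup>2 = \<gamma> *
  (\<rho> i)\<^sup>2\<close>.\<close>

definition \<rho> :: "nat \<Rightarrow> real"
  where "\<rho> k = op_dual_norm B (g k) / op_dual_norm (G k) (g k)"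

lemma \<rho>_ge_1: "\<rho> k \<ge> 1"
  using op_dual_norm_le[of k "g k"] N_pos[of k] by (simp add: \<rho>_def)

lemma Gamma_sum_eq: "Gamma_sum B a g k = (\<Sum>i<k. (\<alpha> i * R + 1/2 * \<theta> * \<gamma> * r i) * \<rho> i)"
  by (simp add: Gamma_sum_def a \<rho>_def)

lemma Gamma_sum_ge_linear: "Gamma_sum B a g k \<ge> 9 / 20 * R * (\<Sum>i<k. \<beta> i)"
  unfolding Gamma_sum_eq sum_distrib_left
proof (rule sum_mono)
  fix i
  have "9 / 20 * R * \<beta> i \<le> \<alpha> i * R"
    using mult_right_mono[OF \<alpha>_ge[of i], of R] R_pos by (simp add: mult_ac)
  also have "\<dots> \<le> \<alpha> i * R + 1/2 * \<theta> * \<gamma> * r i"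
    using \<theta>_bounds \<gamma>_pos r_pos[of i] by simp
  finally have *: "9 / 20 * R * \<beta> i \<le> \<alpha> i * R + 1/2 * \<theta> * \<gamma> * r i" .
  moreover have "0 \<le> 9 / 20 * R * \<beta> i" using R_pos \<beta>_pos[of i] by simp
  ultimately have "(\<alpha> i * R + 1/2 * \<theta> * \<gamma> * r i) * 1 \<le> (\<alpha> i * R + 1/2 * \<theta> * \<gamma> * r i) * \<rho> i"
    using \<rho>_ge_1[of i] by (intro mult_left_mono) linarith+
  then show "9 / 20 * R * \<beta> i \<le> (\<alpha> i * R + 1/2 * \<theta> * \<gamma> * r i) * \<rho> i"
    using * unfolding mult_1_right by (rule order_trans[rotated])
qed

lemma Gamma_sum_ge_exponential:
  assumes "k \<ge> 1"
  shows "Gamma_sum B a g k \<ge> \<theta> / (2 * sqrt 2) * R * (1 + \<gamma>) powr (k / (2 * real DIM('a)))"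
proof -
  let ?n = "real DIM('a)"
  define T where "T = 1 + \<gamma> * (\<Sum>i<k. (\<rho> i)\<^sup>2) / ?n"
  have \<theta>0: "\<theta> > 0" using \<theta>_bounds by simp
  have n: "?n \<ge> 1" using dim by simp
  have T1: "T \<ge> 1" using \<gamma>_pos n by (simp add: T_def sum_nonneg)
  have "b i * (op_dual_norm B (g i))\<^sup>2 = \<gamma> * (\<rho> i)\<^sup>2" for i
    by (simp add: b \<rho>_def power_divide)
  then have "(1 + \<gamma>) ^ k \<le> T ^ DIM('a)"
    using det_le_trace[of k] by (simp add: b_N_sq T_def sum_distrib_left)
  \<comment> \<open>The exponent combines the root of order \<open>DIM('a)\<close> that undoes the
    determinant power with the square root that passes from squared ratios to ratios.\<close>
  then have "((1 + \<gamma>) ^ k) powr (1 / (2 * ?n)) \<le> (T ^ DIM('a)) powr (1 / (2 * ?n))"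
    using \<gamma>_pos by (intro powr_mono2) auto
  then have z: "(1 + \<gamma>) powr (k / (2 * ?n)) \<le> sqrt T"
    using \<gamma>_pos T1 n by (simp add: powr_powr powr_half_sqrt flip: powr_realpow)
  have "sqrt T - 1 \<le> sqrt (T - 1)"
  proof (rule real_le_rsqrt)
    have "sqrt T \<ge> 1" using T1 by simp
    then show "(sqrt T - 1)\<^sup>2 \<le> T - 1"
      using T1 by (simp add: power2_diff)
  qed
  \<comment> \<open>The trace yields the Euclidean norm of the ratios, which is at most their
    sum.\<close>
  also have "\<dots> = sqrt (\<gamma> / ?n) * L2_set \<rho> {..<k}"
    unfolding L2_set_def real_sqrt_mult[symmetric] by (simp add: T_def)
  also have "\<dots> \<le> sqrt (\<gamma> / ?n) * (\<Sum>i<k. \<rho> i)"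
    using \<rho>_ge_1 \<gamma>_pos by (intro mult_left_mono L2_set_le_sum) (auto intro: order_trans[OF zero_le_one])
  also have "\<dots> \<le> sqrt 2 * \<gamma> * (\<Sum>i<k. \<rho> i)"
  proof (rule mult_right_mono)
    have "\<gamma> / ?n \<le> 2 * \<gamma>\<^sup>2"
      using n_gamma_const[OF dim] \<gamma>_pos n by (simp add: \<gamma>[symmetric] field_simps power2_eq_square)
    then have "sqrt (\<gamma> / ?n) \<le> sqrt (2 * \<gamma>\<^sup>2)" by (rule real_sqrt_le_mono)
    then show "sqrt (\<gamma> / ?n) \<le> sqrt 2 * \<gamma>" using \<gamma>_pos by (simp add: real_sqrt_mult)
    show "0 \<le> (\<Sum>i<k. \<rho> i)" using \<rho>_ge_1 by (intro sum_nonneg) (auto intro: order_trans[OF zero_le_one])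
  qed
  finally have "sqrt T \<le> 1 + sqrt 2 * \<gamma> * (\<Sum>i<k. \<rho> i)" by simp
  \<comment> \<open>This multiplier turns \<open>sqrt 2 * \<gamma>\<close> into
    \<open>1/2 * \<theta> * \<gamma>\<close>, the coefficient of \<open>r i\<close> in the
    weights.\<close>
  then have "\<theta> / (2 * sqrt 2) * R * sqrt T
      \<le> \<theta> / (2 * sqrt 2) * R * (1 + sqrt 2 * \<gamma> * (\<Sum>i<k. \<rho> i))"
    using \<theta>0 R_pos by (intro mult_left_mono) auto
  also have "\<dots> = \<theta> / (2 * sqrt 2) * R + (\<Sum>i<k. 1/2 * \<theta> * \<gamma> * R * \<rho> i)"
    by (simp add: sum_distrib_left field_simps)
  also have "\<dots> \<le> (\<Sum>i<k. \<alpha> i * R * \<rho> i) + (\<Sum>i<k. 1/2 * \<theta> * \<gamma> * r i * \<rho> i)"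
  proof (rule add_mono)
    have \<alpha>0: "\<alpha> i \<ge> 0" for i using \<alpha>_ge[of i] \<beta>_pos[of i] by simp
    \<comment> \<open>The leftover 1 is paid for by the \<open>\<alpha>\<close> part of the weight
      with index 0, which is large enough since \<open>\<beta> 0 \<ge> 1\<close>.\<close>
    have "\<theta> / (2 * sqrt 2) \<le> \<theta> / 2"
      using \<theta>0 by (intro divide_left_mono) auto
    also have "\<dots> \<le> \<alpha> 0" using \<theta>_bounds \<alpha>_ge[of 0] \<beta>_0 by linarith
    finally have "\<theta> / (2 * sqrt 2) * R \<le> \<alpha> 0 * R"
      using R_pos by (intro mult_right_mono) auto
    also have "\<dots> \<le> \<alpha> 0 * R * \<rho> 0"
      using mult_left_mono[OF \<rho>_ge_1[of 0], of "\<alpha> 0 * R"] \<alpha>0[of 0] R_pos by simp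
    also have "\<dots> \<le> (\<Sum>i<k. \<alpha> i * R * \<rho> i)"
      using assms \<alpha>0 R_pos \<rho>_ge_1
      by (intro member_le_sum[where f = "\<lambda>i. \<alpha> i * R * \<rho> i"] mult_nonneg_nonneg)
        (auto intro: order_trans[OF zero_le_one])
    finally show "\<theta> / (2 * sqrt 2) * R \<le> (\<Sum>i<k. \<alpha> i * R * \<rho> i)" .
    show "(\<Sum>i<k. 1/2 * \<theta> * \<gamma> * R * \<rho> i) \<le> (\<Sum>i<k. 1/2 * \<theta> * \<gamma> * r i * \<rho> i)"
      using \<theta>0 \<gamma>_pos R_le_r \<rho>_ge_1
      by (intro sum_mono mult_right_mono mult_left_mono) (auto intro: order_trans[OF zero_le_one])
  qed
  also have "\<dots> = Gamma_sum B a g k"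
    unfolding Gamma_sum_eq by (simp add: distrib_right sum.distrib)
  finally have "\<theta> / (2 * sqrt 2) * R * sqrt T \<le> Gamma_sum B a g k" .
  moreover have "\<theta> / (2 * sqrt 2) * R * (1 + \<gamma>) powr (k / (2 * ?n)) \<le> \<theta> / (2 * sqrt 2) * R * sqrt T"
    using z \<theta>0 R_pos by (intro mult_left_mono) auto
  ultimately show ?thesis by linarith
qed

section \<open>From lower bounds on the weights to the two bounds on the gap\<close>

lemma sliding_gap_le_of_Gamma_sum_ge:
  assumes "S > 0" "Gamma_sum B a g k \<ge> S * R"
  shows "sliding_gap B R a g l w k
    \<le> growth_rate \<gamma> ^ k / (2 * S) * (1 + (\<Sum>i<k. (\<beta> i)\<^sup>2)) * R"
proof -
  have SR: "S * R > 0" using assms(1) R_pos by simp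
  then have "Gamma_sum B a g k > 0" using assms(2) by linarith
  then have "sliding_gap B R a g l w k \<le> (r k)\<^sup>2 / (2 * Gamma_sum B a g k)"
    by (rule sliding_gap_le)
  also have "\<dots> \<le> (r k)\<^sup>2 / (2 * (S * R))"
    using assms(2) SR by (intro divide_left_mono) auto
  also have "\<dots> \<le> growth_rate \<gamma> ^ k * (1 + (\<Sum>i<k. (\<beta> i)\<^sup>2)) * R\<^sup>2 / (2 * (S * R))"
    using r_le SR by (intro divide_right_mono) auto
  also have "\<dots> = growth_rate \<gamma> ^ k / (2 * S) * (1 + (\<Sum>i<k. (\<beta> i)\<^sup>2)) * R"
    using R_pos by (simp add: power2_eq_square)
  finally show ?thesis .
qed

lemma sliding_gap_le_first_phase:
  assumes "k \<ge> 1" "k \<le> DIM('a)\<^sup>2"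
  shows "sliding_gap B R a g l w k \<le> 2 / (\<Sum>i<k. \<beta> i) * (1 + (\<Sum>i<k. (\<beta> i)\<^sup>2)) * R"
proof -
  let ?S = "\<Sum>i<k. \<beta> i"
  have S: "?S > 0" using assms(1) \<beta>_pos by (intro sum_pos) (auto simp: lessThan_empty_iff)
  have "sliding_gap B R a g l w k
      \<le> growth_rate \<gamma> ^ k / (2 * (9 / 20 * ?S)) * (1 + (\<Sum>i<k. (\<beta> i)\<^sup>2)) * R"
    using S Gamma_sum_ge_linear[of k]
    by (intro sliding_gap_le_of_Gamma_sum_ge) (auto simp: mult_ac)
  also have "\<dots> \<le> 2 / ?S * (1 + (\<Sum>i<k. (\<beta> i)\<^sup>2)) * R"
  proof (intro mult_right_mono)
    show "growth_rate \<gamma> ^ k / (2 * (9 / 20 * ?S)) \<le> 2 / ?S"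
      using growth_rate_power_le[OF dim assms(2)] S by (simp add: \<gamma> field_simps)
  qed (use R_pos in \<open>auto simp: sum_nonneg add_nonneg_nonneg\<close>)
  finally show ?thesis .
qed

lemma sliding_gap_le_exponential:
  assumes "k \<ge> 1"
  shows "sliding_gap B R a g l w k
    \<le> 6 * exp (- (real k / (8 * (real DIM('a))\<^sup>2))) * (1 + (\<Sum>i<k. (\<beta> i)\<^sup>2)) * R"
proof -
  let ?n = "real DIM('a)"
  let ?z = "(1 + \<gamma>) powr (k / (2 * ?n))"
  have \<theta>0: "\<theta> > 0" using \<theta>_bounds by simp
  have z: "?z > 0" using \<gamma>_pos by simp
  have q: "growth_rate \<gamma> \<ge> 1" using growth_rate_ge_1[OF dim] by (simp add: \<gamma>)
  have "sliding_gap B R a g l w k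
      \<le> growth_rate \<gamma> ^ k / (2 * (\<theta> / (2 * sqrt 2) * ?z)) * (1 + (\<Sum>i<k. (\<beta> i)\<^sup>2)) * R"
    using z \<theta>0 Gamma_sum_ge_exponential[OF assms]
    by (intro sliding_gap_le_of_Gamma_sum_ge) (auto simp: mult_ac)
  also have "\<dots> \<le> 6 * exp (- (real k / (8 * ?n\<^sup>2))) * (1 + (\<Sum>i<k. (\<beta> i)\<^sup>2)) * R"
  proof (intro mult_right_mono)
    have "(growth_rate \<gamma> * exp (1 / (8 * ?n\<^sup>2))) ^ k \<le> ((1 + \<gamma>) powr (1 / (2 * ?n))) ^ k"
      using growth_rate_le[OF dim] q by (intro power_mono) (auto simp: \<gamma>)
    also have "\<dots> = ?z" using \<gamma>_pos by (simp add: powr_powr flip: powr_realpow)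
    finally have "growth_rate \<gamma> ^ k * exp (k / (8 * ?n\<^sup>2)) \<le> ?z"
      by (simp add: power_mult_distrib flip: exp_of_nat_mult)
    then have "growth_rate \<gamma> ^ k / ?z \<le> exp (- (k / (8 * ?n\<^sup>2)))"
      using z by (simp add: exp_minus field_simps)
    \<comment> \<open>\<open>sqrt 2 / \<theta>\<close> is the constant left by the factor
      \<open>\<theta> / (2 * sqrt 2)\<close> of the weight bound.\<close>
    moreover have "sqrt 2 / \<theta> \<le> 6"
    proof -
      have "sqrt 2 \<le> 3 / 2" by (rule real_le_lsqrt) (auto simp: power2_eq_square)
      then show ?thesis using \<theta>_bounds by (simp add: field_simps)
    qed
    ultimately have "sqrt 2 / \<theta> * (growth_rate \<gamma> ^ k / ?z) \<le> 6 * exp (- (k / (8 * ?n\<^sup>2)))"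
      using \<theta>0 q z by (intro mult_mono) auto
    then show "growth_rate \<gamma> ^ k / (2 * (\<theta> / (2 * sqrt 2) * ?z)) \<le> 6 * exp (- (real k / (8 * ?n\<^sup>2)))"
      by (simp add: field_simps)
  qed (use R_pos in \<open>auto simp: sum_nonneg add_nonneg_nonneg\<close>)
  finally show ?thesis .
qed

end

theorem theorem2:
  fixes B :: "'a::euclidean_space \<Rightarrow> 'a dual"
    and orc :: "'a \<Rightarrow> 'a dual"
    and x0 :: 'a
    and n :: nat
    and R :: real
    and a b \<alpha> \<beta> U r :: "nat \<Rightarrow> real"
    and x :: "nat \<Rightarrow> 'a"
    and g :: "nat \<Rightarrow> 'a dual"
    and l w :: "nat \<Rightarrow> 'a \<Rightarrow> real"
    and G :: "nat \<Rightarrow> 'a \<Rightarrow> 'a dual"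
    and \<theta> \<gamma> :: real
  assumes "n = DIM('a)" and "n \<ge> 1"
    and "self_adjoint_pos_def B"
    and "R > 0"
    and "\<exists>xs \<in> op_ball B x0 R. \<forall>y. \<langle>orc y, y - xs\<rangle> \<ge> 0"
    and "general_scheme B orc x0 R a b x g U l w"
    and "hessian_sequence B b g G"
    and "radius_sequence R a b g U G r"
    and "\<theta> = theta_const" and "\<gamma> = gamma_const n"
    and "\<And>k. \<beta> k > 0" and "\<beta> 0 \<ge> 1"
    and "\<And>k. \<alpha> k = \<beta> k * sqrt (\<theta> / (\<theta> + 1))"
    and "\<And>k. a k = (\<alpha> k * R + 1/2 * \<theta> * \<gamma> * r k) / op_dual_norm (G k) (g k)"
    and "\<And>k. b k = \<gamma> / (op_dual_norm (G k) (g k))\<^sup>2"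
    and "\<And>k. g k \<noteq> 0"
  shows "\<forall>k\<ge>1.
    (k \<le> n\<^sup>2 \<longrightarrow>
      sliding_gap B R a g l w k \<le> 2 / (\<Sum>i<k. \<beta> i) * (1 + (\<Sum>i<k. (\<beta> i)\<^sup>2)) * R) \<and>
    (k \<ge> n\<^sup>2 \<longrightarrow>
      sliding_gap B R a g l w k
        \<le> 6 * exp (- (real k / (8 * (real n)\<^sup>2))) * (1 + (\<Sum>i<k. (\<beta> i)\<^sup>2)) * R)"
proof -
  obtain xs where xs: "xs \<in> op_ball B x0 R" "\<And>y. \<langle>orc y, y - xs\<rangle> \<ge> 0"
    using assms(5) by blast
  interpret tuned_scheme_run B orc x0 xs R a b U r x g l w G \<theta> \<gamma> \<alpha> \<beta>
    by unfold_locales (use assms xs in auto)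
  show ?thesis
    using sliding_gap_le_first_phase sliding_gap_le_exponential assms(1) by simp
qed

end
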